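(* A Banach space $X$ admits a locally finite tiling by bounded convex bodies if and only if it admits an equivalent norm that is (K)-polyhedral and has property ($\Delta$).
   Context: All spaces are real. For a normed space $X$, $B_X$ and $S_X$ denote its closed unit ball and unit sphere, and $X^*$ its topological dual. $\operatorname{ext} C$ is the set of extreme points of a convex set $C$. A convex body is a closed convex set with non-empty interior. A tiling of $X$ is a collection of convex bodies that cover $X$ and have mutually disjoint interiors. A tiling is locally finite if each $x\in X$ has a neighbourhood that intersects only finitely many elements of the tiling. A norm has property ($\Delta$) if for every $x\in S_X$ the set $\operatorname{ext}\mathcal D(x)$ is finite, where $\mathcal D(x)=\{f\in S_{X^*}: f(x)=1\}$. A norm is (K)-polyhedral if the unit ball of every finite-dimensional subspace of $X$ is a polytope (the convex hull of finitely many points). *)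

theory Defs
  imports "HOL-Analysis.Analysis"
begin

definition convex_body :: "'a::real_normed_vector set \<Rightarrow> bool" where
  "convex_body C \<longleftrightarrow> closed C \<and> convex C \<and> interior C \<noteq> {}"

definition tiling :: "'a::real_normed_vector set set \<Rightarrow> bool" where
  "tiling T \<longleftrightarrow> (\<forall>C\<in>T. convex_body C) \<and> \<Union>T = UNIV \<and>
     pairwise (\<lambda>A B. disjnt (interior A) (interior B)) T"

(* Since one space carries several norms, a norm is a function N on the fixed type;
   the type-class norm is the given norm of the Banach space. *)

definition is_norm :: "('a::real_vector \<Rightarrow> real) \<Rightarrow> bool" where
  "is_norm N \<longleftrightarrow> (\<forall>x. 0 \<le> N x) \<and> (\<forall>x. N x = 0 \<longleftrightarrow> x = 0) \<and>
     (\<forall>r x. N (r *\<^sub>R x) = \<bar>r\<bar> * N x) \<and> (\<forall>x y. N (x + y) \<le> N x + N y)"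

definition equivalent_norm :: "('a::real_normed_vector \<Rightarrow> real) \<Rightarrow> bool" where
  "equivalent_norm N \<longleftrightarrow> is_norm N \<and>
     (\<exists>c>0. \<exists>C>0. \<forall>x. c * norm x \<le> N x \<and> N x \<le> C * norm x)"

(* Equivalent norms have the same bounded functionals, so the dual of (X, N) is
   the type of bounded linear functionals of X; only the dual norm depends on N.
   The supremum is over a nonempty set that is bounded above when N is equivalent to norm. *)

definition dual_norm :: "('a::real_normed_vector \<Rightarrow> real) \<Rightarrow> ('a \<Rightarrow>\<^sub>L real) \<Rightarrow> real" where
  "dual_norm N f = (SUP x\<in>{x. N x \<le> 1}. \<bar>blinfun_apply f x\<bar>)"

definition norming_functionals ::
    "('a::real_normed_vector \<Rightarrow> real) \<Rightarrow> 'a \<Rightarrow> ('a \<Rightarrow>\<^sub>L real) set" where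
  "norming_functionals N x = {f. dual_norm N f = 1 \<and> blinfun_apply f x = 1}"

definition property_Delta :: "('a::real_normed_vector \<Rightarrow> real) \<Rightarrow> bool" where
  "property_Delta N \<longleftrightarrow>
     (\<forall>x. N x = 1 \<longrightarrow> finite {f. f extreme_point_of norming_functionals N x})"

definition K_polyhedral :: "('a::real_vector \<Rightarrow> real) \<Rightarrow> bool" where
  "K_polyhedral N \<longleftrightarrow>
     (\<forall>S. subspace S \<and> (\<exists>B. finite B \<and> S = span B) \<longrightarrow> polytope {x \<in> S. N x \<le> 1})"

end

theory Submission
  imports Defs
begin

text \<open>
  Both sides of the equivalence say that some equivalent norm \<open>N\<close> is \<^emph>\<open>locally polyhedral\<close>: near each
  point of its unit sphere, \<open>N\<close> coincides with the maximum of finitely many functionals that lie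
  below \<open>N\<close> everywhere.

  \<^item> \<^emph>\<open>From a tiling to a norm.\<close>  Take a tile \<open>C\<close>, move an interior point of it to the origin, and let
    \<open>N\<close> be the Minkowski functional of the intersection of \<open>C\<close> with \<open>- C\<close>.  Only finitely many other tiles come
    close to a given point, and the functionals that separate \<open>C\<close> from them describe \<open>C\<close> near that
    point: a nearby point that satisfies all these inequalities strictly lies in none of the other
    tiles, hence in \<open>C\<close>.  See \<open>tiling_imp_locally_polyhedral_norm\<close>.

  \<^item> \<^emph>\<open>From a norm to a tiling.\<close>  For a locally polyhedral \<open>N\<close> the cones over the facets of the unit
    sphere cover all points but possibly the origin, and only finitely many of them come near such a point.  On
    the cone over a facet \<open>N\<close> is linear, so slicing the cone at the integer values of \<open>N\<close> yields
    convex bodies; together with the unit ball they form the tiling.  See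
    \<open>locally_polyhedral_imp_tiling\<close>.

  \<^item> \<^emph>\<open>Locally polyhedral norms are (K)-polyhedral with property Delta.\<close>  On a finite-dimensional
    subspace, compactness of the sphere leaves finitely many functionals, and a bounded intersection
    of finitely many half-spaces is a polytope.  At a point \<open>x\<close> of the sphere, Farkas' lemma shows
    that every norming functional of \<open>x\<close> is a convex combination of the finitely many functionals that
    are active at \<open>x\<close>, so these contain all extreme ones.

  \<^item> \<^emph>\<open>The converse\<close> is the part that needs completeness.  Let \<open>E\<close> be the finite set of extreme norming
    functionals at \<open>x\<close>.  Each directional derivative of \<open>N\<close> at \<open>x\<close> is attained by an element of \<open>E\<close>
    (\<open>extreme_functional_attains_dir_deriv\<close>), and since the planar sections of the ball are polygons, \<open>N\<close>
    agrees with that element on a short segment from \<open>x\<close> (\<open>polytope_norm_affine_along_ray\<close>).  The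
    length of the segment depends on the direction.  It can be bounded from below because, for each
    \<open>g\<close> in \<open>E\<close>, the displacements from \<open>x\<close> to the points where \<open>N\<close> equals \<open>g\<close> form a closed convex set
    that absorbs the polyhedral cone of the directions in which \<open>g\<close> is the largest element of \<open>E\<close>; by
    Baire's theorem and an induction over the faces of the cone, such a set contains a
    neighbourhood of the origin in the cone (\<open>absorbing_polyhedral_cone\<close>).

  The Hahn--Banach theorem and the existence of extreme norming functionals are obtained together, by a
  single application of Zorn's lemma to sublinear functionals (\<open>extreme_linear_minorant\<close>).
\<close>

section \<open>Sublinear functionals and extreme linear minorants\<close>

definition sublinear :: "('a::real_vector \<Rightarrow> real) \<Rightarrow> bool" where
  "sublinear p \<longleftrightarrow> (\<forall>x y. p (x + y) \<le> p x + p y) \<and> (\<forall>t x. 0 \<le> t \<longrightarrow> p (t *\<^sub>R x) = t * p x)"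

lemma sublinear_add: "sublinear p \<Longrightarrow> p (x + y) \<le> p x + p y"
  and sublinear_scale: "sublinear p \<Longrightarrow> 0 \<le> t \<Longrightarrow> p (t *\<^sub>R x) = t * p x"
  by (auto simp: sublinear_def)

lemma sublinear_zero: "sublinear p \<Longrightarrow> p 0 = 0"
  using sublinear_scale[of p 0 0] by simp

lemma sublinear_minus: "sublinear p \<Longrightarrow> - p (- x) \<le> p x"
  using sublinear_add[of p x "- x"] sublinear_zero[of p] by simp

text \<open>The infimum is also the limit as \<open>t\<close> decreases to \<open>0\<close>, that is, the one-sided derivative of
  \<open>p\<close> at \<open>v\<close> in direction \<open>u\<close>, because the quotient is monotone in \<open>t\<close>.\<close>

definition dir_deriv :: "('a::real_vector \<Rightarrow> real) \<Rightarrow> 'a \<Rightarrow> 'a \<Rightarrow> real" where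
  "dir_deriv p v u = (INF t\<in>{0<..}. (p (v + t *\<^sub>R u) - p v) / t)"

lemma dir_quotient_lower:
  assumes "sublinear p" "0 < t"
  shows "- p (- u) \<le> (p (v + t *\<^sub>R u) - p v) / t"
proof -
  have "p v \<le> p (v + t *\<^sub>R u) + p (t *\<^sub>R (- u))"
    using sublinear_add[OF assms(1), of "v + t *\<^sub>R u" "t *\<^sub>R (- u)"] by simp
  also have "p (t *\<^sub>R (- u)) = t * p (- u)"
    using sublinear_scale[OF assms(1), of t "- u"] assms(2) by simp
  finally show ?thesis
    using assms(2) by (simp add: pos_le_divide_eq algebra_simps)
qed

lemma dir_quotient_bdd_below:
  "sublinear p \<Longrightarrow> bdd_below ((\<lambda>t. (p (v + t *\<^sub>R u) - p v) / t) ` {0<..})"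
  using dir_quotient_lower by (intro bdd_belowI2[where m="- p (- u)"]) auto

lemma dir_deriv_le: "sublinear p \<Longrightarrow> 0 < t \<Longrightarrow> dir_deriv p v u \<le> (p (v + t *\<^sub>R u) - p v) / t"
  unfolding dir_deriv_def by (rule cINF_lower[OF dir_quotient_bdd_below]) auto

lemma dir_deriv_greatest:
  "(\<And>t. 0 < t \<Longrightarrow> m \<le> (p (v + t *\<^sub>R u) - p v) / t) \<Longrightarrow> m \<le> dir_deriv p v u"
  unfolding dir_deriv_def by (rule cINF_greatest) (auto intro: exI[of _ 1])

lemma dir_deriv_less:
  assumes "sublinear p" "dir_deriv p v u < m"
  obtains t where "0 < t" "(p (v + t *\<^sub>R u) - p v) / t < m"
  using assms(2) cINF_less_iff[OF _ dir_quotient_bdd_below[OF assms(1)], of v u m]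
  unfolding dir_deriv_def by auto

text \<open>Convexity along the ray.  It allows two step lengths to be replaced by a common smaller one, on
  which the subadditivity of the directional derivative depends.\<close>

lemma dir_quotient_mono:
  assumes p: "sublinear p" and "0 < s" "s \<le> t"
  shows "(p (v + s *\<^sub>R u) - p v) / s \<le> (p (v + t *\<^sub>R u) - p v) / t"
proof -
  have "v + s *\<^sub>R u = (1 - s/t) *\<^sub>R v + (s/t) *\<^sub>R (v + t *\<^sub>R u)"
    using assms by (simp add: algebra_simps)
  then have "p (v + s *\<^sub>R u) \<le> p ((1 - s/t) *\<^sub>R v) + p ((s/t) *\<^sub>R (v + t *\<^sub>R u))"
    by (metis sublinear_add[OF p])
  also have "\<dots> = (1 - s/t) * p v + (s/t) * p (v + t *\<^sub>R u)"
    using sublinear_scale[OF p, of "1 - s/t"] sublinear_scale[OF p, of "s/t"] assms by simp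
  finally have "p (v + s *\<^sub>R u) \<le> (1 - s/t) * p v + (s/t) * p (v + t *\<^sub>R u)" .
  then have "p (v + s *\<^sub>R u) - p v \<le> s * ((p (v + t *\<^sub>R u) - p v) / t)"
    by (simp add: algebra_simps diff_divide_distrib)
  then show ?thesis
    using assms by (simp add: pos_divide_le_eq mult.commute)
qed

lemma dir_deriv_sublinear:
  assumes p: "sublinear p"
  shows "sublinear (dir_deriv p v)"
  unfolding sublinear_def
proof (intro conjI allI impI)
  fix x y
  show "dir_deriv p v (x + y) \<le> dir_deriv p v x + dir_deriv p v y"
  proof (rule field_le_epsilon)
    fix e :: real assume "0 < e"
    then have ex: "dir_deriv p v x < dir_deriv p v x + e/2" and ey: "dir_deriv p v y < dir_deriv p v y + e/2"
      by simp_all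
    obtain s where s: "0 < s" "(p (v + s *\<^sub>R x) - p v) / s < dir_deriv p v x + e/2"
      using dir_deriv_less[OF p ex] .
    obtain t where t: "0 < t" "(p (v + t *\<^sub>R y) - p v) / t < dir_deriv p v y + e/2"
      using dir_deriv_less[OF p ey] .
    define r where "r = min s t / 2"
    have r: "0 < r" "2 * r \<le> s" "2 * r \<le> t" using s t by (auto simp: r_def)
    have "v + r *\<^sub>R (x + y) = (1/2) *\<^sub>R (v + (2*r) *\<^sub>R x) + (1/2) *\<^sub>R (v + (2*r) *\<^sub>R y)"
      by (simp add: algebra_simps flip: scaleR_left_distrib)
    then have "p (v + r *\<^sub>R (x + y)) \<le> p (v + (2*r) *\<^sub>R x) / 2 + p (v + (2*r) *\<^sub>R y) / 2"
      using sublinear_add[OF p, of "(1/2) *\<^sub>R (v + (2*r) *\<^sub>R x)" "(1/2) *\<^sub>R (v + (2*r) *\<^sub>R y)"]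
        sublinear_scale[OF p, of "1/2"] by simp
    then have "(p (v + r *\<^sub>R (x + y)) - p v) / r
      \<le> (p (v + (2*r) *\<^sub>R x) / 2 + p (v + (2*r) *\<^sub>R y) / 2 - p v) / r"
      using r by (intro divide_right_mono) auto
    also have "\<dots> = (p (v + (2*r) *\<^sub>R x) - p v) / (2*r) + (p (v + (2*r) *\<^sub>R y) - p v) / (2*r)"
      using r by (simp add: divide_simps)
    also have "\<dots> \<le> (p (v + s *\<^sub>R x) - p v) / s + (p (v + t *\<^sub>R y) - p v) / t"
      using dir_quotient_mono[OF p _ r(2)] dir_quotient_mono[OF p _ r(3)] r(1)
      by (intro add_mono) auto
    also have "\<dots> \<le> dir_deriv p v x + dir_deriv p v y + e"
      using s t by simp
    finally show "dir_deriv p v (x + y) \<le> dir_deriv p v x + dir_deriv p v y + e"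
      using dir_deriv_le[OF p r(1), of v "x + y"] by simp
  qed
next
  have le: "dir_deriv p v (c *\<^sub>R x) \<le> c * dir_deriv p v x" if "0 < c" for c x
  proof -
    have "dir_deriv p v (c *\<^sub>R x) / c \<le> dir_deriv p v x"
    proof (rule dir_deriv_greatest)
      fix t :: real assume "0 < t"
      then have "dir_deriv p v (c *\<^sub>R x) \<le> (p (v + (t/c) *\<^sub>R (c *\<^sub>R x)) - p v) / (t/c)"
        using that by (intro dir_deriv_le[OF p]) auto
      then show "dir_deriv p v (c *\<^sub>R x) / c \<le> (p (v + t *\<^sub>R x) - p v) / t"
        using that \<open>0 < t\<close> by (simp add: field_simps)
    qed
    then show ?thesis using that by (simp add: field_simps)
  qed
  fix t :: real and x assume t: "0 \<le> t"
  show "dir_deriv p v (t *\<^sub>R x) = t * dir_deriv p v x"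
  proof (cases "t = 0")
    case True
    then show ?thesis by (simp add: dir_deriv_def)
  next
    case False
    then have "0 < t" using t by simp
    then have "dir_deriv p v x \<le> (1/t) * dir_deriv p v (t *\<^sub>R x)"
      using le[of "1/t" "t *\<^sub>R x"] by simp
    then show ?thesis
      using le[OF \<open>0 < t\<close>, of x] \<open>0 < t\<close> by (simp add: field_simps)
  qed
qed

lemma dir_deriv_le_self:
  assumes "sublinear p" shows "dir_deriv p v u \<le> p u"
  using dir_deriv_le[OF assms zero_less_one, of v u] sublinear_add[OF assms, of v u] by simp

lemma dir_deriv_uminus:
  assumes p: "sublinear p" shows "dir_deriv p v (- v) \<le> - p v"
  using dir_deriv_le[OF p zero_less_one, of v "- v"] sublinear_zero[OF p] by simp

text \<open>Geometrically, passing from \<open>p\<close> to its directional derivative at \<open>v\<close> cuts out the face of the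
  set of linear minorants on which evaluation at \<open>v\<close> is maximal.\<close>

lemma linear_le_dir_deriv_iff:
  assumes p: "sublinear p" and f: "linear f"
  shows "(\<forall>u. f u \<le> dir_deriv p v u) \<longleftrightarrow> (\<forall>u. f u \<le> p u) \<and> f v = p v"
proof (intro iffI conjI allI; (elim conjE)?)
  assume *: "\<forall>u. f u \<le> dir_deriv p v u"
  show le: "f u \<le> p u" for u
    using * dir_deriv_le_self[OF p] order_trans by blast
  have "- f v \<le> - p v"
    using *[rule_format, of "- v"] dir_deriv_uminus[OF p, of v] linear_neg[OF f, of v] by linarith
  then show "f v = p v" using le[of v] by simp
next
  fix u assume le: "\<forall>u. f u \<le> p u" and eq: "f v = p v"
  show "f u \<le> dir_deriv p v u"
  proof (rule dir_deriv_greatest)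
    fix t :: real assume "0 < t"
    moreover have "f (v + t *\<^sub>R u) = p v + t * f u"
      using linear_add[OF f] linear_scale[OF f] eq by simp
    ultimately show "f u \<le> (p (v + t *\<^sub>R u) - p v) / t"
      using le by (simp add: pos_le_divide_eq algebra_simps) (metis le)
  qed
qed

lemma sublinear_linear:
  assumes q: "sublinear q" and odd: "\<And>w. q (- w) = - q w"
  shows "linear q"
proof (rule linearI)
  fix x y
  have "q (- x + - y) \<le> q (- x) + q (- y)" by (rule sublinear_add[OF q])
  then have "- q (x + y) \<le> - q x - q y" using odd[of "x + y"] odd by simp
  then show "q (x + y) = q x + q y" using sublinear_add[OF q, of x y] by simp
next
  fix r x show "q (r *\<^sub>R x) = r *\<^sub>R q x"
  proof (cases "0 \<le> r")
    case True then show ?thesis using sublinear_scale[OF q] by simp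
  next
    case False
    then have "q ((- r) *\<^sub>R x) = (- r) * q x" by (intro sublinear_scale[OF q]) simp
    then show ?thesis using odd[of "r *\<^sub>R x"] by simp
  qed
qed

text \<open>For sublinear \<open>q\<close> this says that the linear minorants of \<open>q\<close> form a face of the convex set of
  linear minorants of \<open>p\<close>.  Faces are described by the functional \<open>q\<close> rather than as sets of
  functionals, so that decreasing families have an obvious lower bound, the pointwise infimum.\<close>

definition minorant_face :: "('a::real_vector \<Rightarrow> real) \<Rightarrow> ('a \<Rightarrow> real) \<Rightarrow> bool" where
  "minorant_face p q \<longleftrightarrow> (\<forall>u. q u \<le> p u) \<and>
     (\<forall>g h c. linear g \<longrightarrow> linear h \<longrightarrow> (\<forall>u. g u \<le> p u) \<longrightarrow> (\<forall>u. h u \<le> p u) \<longrightarrow> 0 < c \<longrightarrow> c < 1 \<longrightarrow>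
        (\<forall>u. (1 - c) * g u + c * h u \<le> q u) \<longrightarrow> (\<forall>u. g u \<le> q u) \<and> (\<forall>u. h u \<le> q u))"

text \<open>Requiring a minorant of \<open>q\<close> to touch \<open>q\<close> at \<open>v\<close> cuts out a face of the face given by \<open>q\<close>, and a
  face of a face is a face.\<close>

lemma minorant_face_dir_deriv:
  assumes q: "sublinear q" and face: "minorant_face p q"
  shows "minorant_face p (dir_deriv q v)"
  unfolding minorant_face_def
proof (intro conjI allI impI)
  show "dir_deriv q v u \<le> p u" for u
    using dir_deriv_le_self[OF q, of v u] face order_trans unfolding minorant_face_def by blast
next
  fix g h :: "'a \<Rightarrow> real" and c :: real
  assume g: "linear g" "\<forall>u. g u \<le> p u" and h: "linear h" "\<forall>u. h u \<le> p u" and c: "0 < c" "c < 1"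
    and le: "\<forall>u. (1 - c) * g u + c * h u \<le> dir_deriv q v u"
  have "\<forall>u. (1 - c) * g u + c * h u \<le> q u"
    using le dir_deriv_le_self[OF q] order_trans by blast
  then have gh: "\<forall>u. g u \<le> q u" "\<forall>u. h u \<le> q u"
    using face g h c unfolding minorant_face_def by blast+
  have "linear (\<lambda>u. (1 - c) * g u + c * h u)"
    using linear_compose_add[OF linear_compose_scale_right[OF g(1), of "1 - c"]
        linear_compose_scale_right[OF h(1), of c]] by simp
  then have eq: "(1 - c) * g v + c * h v = q v"
    using linear_le_dir_deriv_iff[OF q] le by blast
  \<comment> \<open>a proper convex combination of two numbers below \<open>q v\<close> reaches \<open>q v\<close> only if both do\<close>
  have "(1 - c) * (q v - g v) + c * (q v - h v) = 0"
    using eq by (simp add: algebra_simps)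
  moreover have "0 \<le> (1 - c) * (q v - g v)" "0 \<le> c * (q v - h v)"
    using c gh by auto
  ultimately have "(1 - c) * (q v - g v) = 0" "c * (q v - h v) = 0"
    by linarith+
  then have "g v = q v" "h v = q v" using c by auto
  then have "\<forall>u. g u \<le> dir_deriv q v u" "\<forall>u. h u \<le> dir_deriv q v u"
    using linear_le_dir_deriv_iff[OF q g(1)] linear_le_dir_deriv_iff[OF q h(1)] gh by auto
  then show "g u \<le> dir_deriv q v u" "h u \<le> dir_deriv q v u" for u by auto
qed

text \<open>Along a chain, two members can be replaced by the smaller one, which is why subadditivity
  survives the infimum.  The chain is bounded below at \<open>u\<close> since \<open>- q (- u) \<le> q u\<close>.\<close>

lemma Inf_chain_sublinear:
  assumes ne: "C \<noteq> {}" and sub: "\<And>q. q \<in> C \<Longrightarrow> sublinear q"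
    and chain: "\<And>q r. q \<in> C \<Longrightarrow> r \<in> C \<Longrightarrow> (\<forall>u. q u \<le> r u) \<or> (\<forall>u. r u \<le> q u)"
  shows "\<And>u. bdd_below ((\<lambda>q. q u) ` C)" and "sublinear (\<lambda>u. INF q\<in>C. q u)"
proof -
  obtain q0 where q0: "q0 \<in> C" using ne by blast
  show bdd: "bdd_below ((\<lambda>q. q u) ` C)" for u
  proof (rule bdd_belowI2[where m="min (q0 u) (- q0 (- u))"])
    fix q assume q: "q \<in> C"
    show "min (q0 u) (- q0 (- u)) \<le> q u"
      using chain[OF q q0]
    proof
      assume "\<forall>u. q u \<le> q0 u"
      then have "q (- u) \<le> q0 (- u)" by blast
      then show ?thesis using sublinear_minus[OF sub[OF q], of u] by linarith
    qed (simp add: min.coboundedI1)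
  qed
  show "sublinear (\<lambda>u. INF q\<in>C. q u)"
    unfolding sublinear_def
  proof (intro conjI allI impI)
    fix x y
    have "(INF q\<in>C. q (x + y)) - q x \<le> (INF q\<in>C. q y)" if q: "q \<in> C" for q
    proof (rule cINF_greatest[OF ne])
      fix r assume r: "r \<in> C"
      obtain s where s: "s \<in> C" "\<And>u. s u \<le> q u" "\<And>u. s u \<le> r u"
        using chain[OF q r] q r by (metis order_refl)
      have "(INF q\<in>C. q (x + y)) \<le> s (x + y)" by (rule cINF_lower[OF bdd s(1)])
      also have "\<dots> \<le> q x + r y"
        using sublinear_add[OF sub[OF s(1)], of x y] s(2)[of x] s(3)[of y] by linarith
      finally show "(INF q\<in>C. q (x + y)) - q x \<le> r y" by simp
    qed
    then have "(INF q\<in>C. q (x + y)) - (INF q\<in>C. q y) \<le> (INF q\<in>C. q x)"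
      by (intro cINF_greatest[OF ne]) (simp add: algebra_simps)
    then show "(INF q\<in>C. q (x + y)) \<le> (INF q\<in>C. q x) + (INF q\<in>C. q y)" by simp
  next
    have le: "(INF q\<in>C. q (c *\<^sub>R x)) \<le> c * (INF q\<in>C. q x)" if "0 < c" for c x
    proof -
      have "(INF q\<in>C. q (c *\<^sub>R x)) / c \<le> (INF q\<in>C. q x)"
      proof (rule cINF_greatest[OF ne])
        fix q assume q: "q \<in> C"
        have "(INF q\<in>C. q (c *\<^sub>R x)) \<le> q (c *\<^sub>R x)" by (rule cINF_lower[OF bdd q])
        then show "(INF q\<in>C. q (c *\<^sub>R x)) / c \<le> q x"
          using sublinear_scale[OF sub[OF q], of c x] that by (simp add: field_simps)
      qed
      then show ?thesis using that by (simp add: field_simps)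
    qed
    fix t :: real and x assume t: "0 \<le> t"
    show "(INF q\<in>C. q (t *\<^sub>R x)) = t * (INF q\<in>C. q x)"
    proof (cases "t = 0")
      case True
      have "(INF q\<in>C. q 0) = (INF q\<in>C. 0::real)"
        by (intro INF_cong refl sublinear_zero sub)
      then show ?thesis using True ne by simp
    next
      case False
      then have "0 < t" using t by simp
      then have "(INF q\<in>C. q x) \<le> (1/t) * (INF q\<in>C. q (t *\<^sub>R x))"
        using le[of "1/t" "t *\<^sub>R x"] by simp
      then show ?thesis
        using le[OF \<open>0 < t\<close>, of x] \<open>0 < t\<close> by (simp add: field_simps)
    qed
  qed
qed

text \<open>This combines the Hahn--Banach theorem with the existence of extreme points.  Among the sublinear
  functionals that describe a face and lie below the directional derivative at \<open>v\<close>, Zorn's lemma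
  gives a minimal one.  It equals all its own directional derivatives, which lie below it and are
  again of this kind, so it is odd and hence linear; a face with a linear describing
  functional consists of that functional only, so the functional is extreme.\<close>

lemma extreme_linear_minorant:
  assumes p: "sublinear p"
  obtains f where "linear f" "\<And>u. f u \<le> p u" "f v = p v"
    "\<And>g h c. \<lbrakk>linear g; linear h; \<forall>u. g u \<le> p u; \<forall>u. h u \<le> p u; 0 < c; c < 1;
       \<forall>u. f u = (1 - c) * g u + c * h u\<rbrakk> \<Longrightarrow> g = f \<and> h = f"
proof -
  define Q where "Q = {q. sublinear q \<and> minorant_face p q \<and> (\<forall>u. q u \<le> dir_deriv p v u)}"
  have "minorant_face p p" by (simp add: minorant_face_def)
  then have pQ: "dir_deriv p v \<in> Q"
    using p by (simp add: Q_def dir_deriv_sublinear minorant_face_dir_deriv)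
  let ?P = "\<lambda>q r :: 'a \<Rightarrow> real. \<forall>u. r u \<le> q u"
  have "\<exists>m\<in>Q. \<forall>q\<in>Q. ?P m q \<longrightarrow> q = m"
  proof (rule predicate_Zorn)
    show "partial_order_on Q (relation_of ?P Q)"
      by (rule partial_order_on_relation_ofI) (auto intro: order_trans, metis ext order_antisym)
  next
    fix C assume C: "C \<in> Chains (relation_of ?P Q)"
    show "\<exists>u\<in>Q. \<forall>q\<in>C. ?P q u"
    proof (cases "C = {}")
      case True then show ?thesis using pQ by blast
    next
      case False
      have CQ: "C \<subseteq> Q" and chain: "\<And>q r. q \<in> C \<Longrightarrow> r \<in> C \<Longrightarrow> ?P r q \<or> ?P q r"
        using C unfolding Chains_def relation_of_def by auto
      have sub: "\<And>q. q \<in> C \<Longrightarrow> sublinear q" using CQ by (auto simp: Q_def)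
      have bdd: "bdd_below ((\<lambda>q. q u) ` C)" for u
        by (rule Inf_chain_sublinear(1)[OF False]) (use sub chain in blast)+
      have m: "sublinear (\<lambda>u. INF q\<in>C. q u)"
        by (rule Inf_chain_sublinear(2)[OF False]) (use sub chain in blast)+
      have low: "(INF q\<in>C. q u) \<le> q u" if "q \<in> C" for q u
        by (rule cINF_lower[OF bdd that])
      obtain q0 where q0: "q0 \<in> C" using False by blast
      have "minorant_face p (\<lambda>u. INF q\<in>C. q u)"
        unfolding minorant_face_def
      proof (intro conjI allI impI)
        show "(INF q\<in>C. q u) \<le> p u" for u
          using low[OF q0, of u] q0 CQ unfolding Q_def minorant_face_def by (force intro: order_trans)
      next
        fix g h :: "'a \<Rightarrow> real" and c :: real and u
        assume *: "linear g" "linear h" "\<forall>u. g u \<le> p u" "\<forall>u. h u \<le> p u" "0 < c" "c < 1"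
          and le: "\<forall>u. (1 - c) * g u + c * h u \<le> (INF q\<in>C. q u)"
        have "g u \<le> q u \<and> h u \<le> q u" if q: "q \<in> C" for q
        proof -
          have "minorant_face p q" using q CQ by (auto simp: Q_def)
          moreover have "\<forall>u. (1 - c) * g u + c * h u \<le> q u"
            using le low[OF q] order_trans by blast
          ultimately show ?thesis using * unfolding minorant_face_def by blast
        qed
        then show "g u \<le> (INF q\<in>C. q u)" "h u \<le> (INF q\<in>C. q u)"
          by (auto intro: cINF_greatest[OF False])
      qed
      moreover have "(INF q\<in>C. q u) \<le> dir_deriv p v u" for u
        using low[OF q0, of u] q0 CQ unfolding Q_def by (force intro: order_trans)
      ultimately have "(\<lambda>u. INF q\<in>C. q u) \<in> Q" using m by (simp add: Q_def)
      then show ?thesis using low by (intro bexI[of _ "\<lambda>u. INF q\<in>C. q u"]) auto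
    qed
  qed
  then obtain f where f: "f \<in> Q" and min: "\<And>q. q \<in> Q \<Longrightarrow> \<forall>u. q u \<le> f u \<Longrightarrow> q = f" by blast
  have fs: "sublinear f" and face: "minorant_face p f" and fd: "\<And>u. f u \<le> dir_deriv p v u"
    using f by (auto simp: Q_def)
  have "f (- w) = - f w" for w
  proof -
    have "dir_deriv f w \<in> Q"
      using fs face fd dir_deriv_le_self[OF fs, of w]
      by (auto simp: Q_def dir_deriv_sublinear minorant_face_dir_deriv intro: order_trans)
    then have "dir_deriv f w = f" using min dir_deriv_le_self[OF fs] by blast
    then have "f (- w) \<le> - f w" using dir_deriv_uminus[OF fs, of w] by simp
    then show ?thesis using sublinear_minus[OF fs, of w] by simp
  qed
  then have lin: "linear f" by (rule sublinear_linear[OF fs])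
  have le: "\<forall>u. f u \<le> p u" and eq: "f v = p v"
    using linear_le_dir_deriv_iff[OF p lin] fd by blast+
  show thesis
  proof (rule that[OF lin _ eq])
    show "f u \<le> p u" for u using le by blast
    fix g h :: "'a \<Rightarrow> real" and c :: real
    assume *: "linear g" "linear h" "\<forall>u. g u \<le> p u" "\<forall>u. h u \<le> p u" "0 < c" "c < 1"
      and comb: "\<forall>u. f u = (1 - c) * g u + c * h u"
    then have "\<forall>u. g u \<le> f u" "\<forall>u. h u \<le> f u"
      using face comb unfolding minorant_face_def by (metis order_refl)+
    moreover have "k = f" if "linear k" "\<forall>u. k u \<le> f u" for k
    proof
      fix u show "k u = f u"
        using that(2)[rule_format, of u] that(2)[rule_format, of "- u"]
          linear_neg[OF that(1), of u] linear_neg[OF lin, of u] by linarith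
    qed
    ultimately show "g = f \<and> h = f" using * by blast
  qed
qed

section \<open>Farkas' lemma\<close>

text \<open>Bartl's induction on the number of inequalities.  If the inequality \<open>h k\<close> cannot be dropped,
  there is a vector \<open>u\<close> that violates the conclusion but satisfies all the others; projecting along
  \<open>u\<close> onto the kernel of \<open>h k\<close> removes this inequality, and the coefficient of \<open>h k\<close> that results
  from undoing the projection is positive.\<close>

lemma farkas:
  fixes f :: "'v::real_vector \<Rightarrow> real" and h :: "'i \<Rightarrow> 'v \<Rightarrow> real"
  assumes "finite I" "linear f" "\<And>i. i \<in> I \<Longrightarrow> linear (h i)"
    and "\<And>v. (\<And>i. i \<in> I \<Longrightarrow> h i v \<le> 0) \<Longrightarrow> f v \<le> 0"
  shows "\<exists>c. (\<forall>i\<in>I. 0 \<le> c i) \<and> (\<forall>v. f v = (\<Sum>i\<in>I. c i * h i v))"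
  using assms
proof (induction I arbitrary: f h rule: finite_induct)
  case empty
  have "f v = 0" for v
    using empty.prems(3)[of v] empty.prems(3)[of "- v"] linear_neg[OF empty.prems(1), of v] by simp
  then show ?case by simp
next
  case (insert k I)
  note f = insert.prems(1)
  have h: "linear (h i)" if "i \<in> insert k I" for i by (rule insert.prems(2)[OF that])
  show ?case
  proof (cases "\<forall>v. (\<forall>i\<in>I. h i v \<le> 0) \<longrightarrow> f v \<le> 0")
    case True
    then obtain c where c: "\<forall>i\<in>I. 0 \<le> c i" "\<forall>v. f v = (\<Sum>i\<in>I. c i * h i v)"
      using insert.IH[OF f, of h] h by auto
    have "(\<Sum>i\<in>insert k I. (c(k := 0)) i * h i v) = (\<Sum>i\<in>I. c i * h i v)" for v
      using insert.hyps by (auto intro!: sum.cong)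
    with c show ?thesis
      by (intro exI[of _ "c(k := 0)"]) auto
  next
    case False
    then obtain w where w: "\<And>i. i \<in> I \<Longrightarrow> h i w \<le> 0" "0 < f w" by force
    have "0 < h k w"
      using insert.prems(3)[of w] w by force
    define u where "u = (1 / h k w) *\<^sub>R w"
    have u: "h k u = 1" "0 < f u" "\<And>i. i \<in> I \<Longrightarrow> h i u \<le> 0"
      using \<open>0 < h k w\<close> w f h by (auto simp: u_def linear_scale divide_nonpos_pos)
    define h' where "h' = (\<lambda>i v. h i v - h i u * h k v)"
    define f' where "f' = (\<lambda>v. f v - f u * h k v)"
    \<comment> \<open>\<open>h'\<close> and \<open>f'\<close> are \<open>h\<close> and \<open>f\<close> composed with the projection along \<open>u\<close> onto the kernel of \<open>h k\<close>\<close>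
    have proj: "h' i v = h i (v - h k v *\<^sub>R u)" if "i \<in> insert k I" for i v
      using h[OF that] by (simp add: h'_def linear_diff linear_scale)
    have projf: "f' v = f (v - h k v *\<^sub>R u)" for v
      using f by (simp add: f'_def linear_diff linear_scale)
    have "linear f'"
      unfolding f'_def using linear_compose_sub[OF f linear_compose_scale_right[OF h[of k], of "f u"]] by simp
    moreover have "linear (h' i)" if "i \<in> I" for i
      unfolding h'_def
      using linear_compose_sub[OF h[of i] linear_compose_scale_right[OF h[of k], of "h i u"]] that by simp
    moreover have "f' v \<le> 0" if "\<And>i. i \<in> I \<Longrightarrow> h' i v \<le> 0" for v
    proof -
      have "h k (v - h k v *\<^sub>R u) = 0"
        using h[of k] u by (simp add: linear_diff linear_scale)
      then show ?thesis
        unfolding projf using that proj by (intro insert.prems(3)) auto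
    qed
    ultimately obtain c where c: "\<forall>i\<in>I. 0 \<le> c i" "\<And>v. f' v = (\<Sum>i\<in>I. c i * h' i v)"
      using insert.IH[of f' h'] by blast
    define d where "d = c(k := f u - (\<Sum>i\<in>I. c i * h i u))"
    have "(\<Sum>i\<in>I. c i * h i u) \<le> 0"
      using c(1) u(3) by (intro sum_nonpos) (simp add: mult_nonneg_nonpos)
    then have "\<forall>i\<in>insert k I. 0 \<le> d i"
      using c(1) u(2) by (auto simp: d_def)
    moreover have "f v = (\<Sum>i\<in>insert k I. d i * h i v)" for v
    proof -
      have "(\<Sum>i\<in>insert k I. d i * h i v) = d k * h k v + (\<Sum>i\<in>I. c i * h i v)"
        using insert.hyps by (auto simp: d_def intro!: sum.cong)
      also have "\<dots> = f u * h k v + (\<Sum>i\<in>I. c i * h' i v)"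
        by (simp add: d_def h'_def algebra_simps sum_subtractf sum_distrib_left)
      also have "\<dots> = f v" using c(2)[of v] by (simp add: f'_def)
      finally show ?thesis by simp
    qed
    ultimately show ?thesis by blast
  qed
qed

text \<open>Adding a real coordinate makes Farkas' lemma return coefficients of sum \<open>1\<close>: the maximum of
  \<open>G\<close> at \<open>v\<close> is at most \<open>s\<close> if and only if \<open>(v, s)\<close> satisfies \<open>g v - s \<le> 0\<close> for all \<open>g\<close> in \<open>G\<close>.\<close>

lemma le_Max_imp_convex_hull:
  fixes f :: "'a::real_normed_vector \<Rightarrow>\<^sub>L real"
  assumes "finite G" and le: "\<And>v. \<exists>g\<in>G. f v \<le> blinfun_apply g v"
  shows "f \<in> convex hull G"
proof -
  have lin: "linear (\<lambda>z. blinfun_apply g (fst z) - snd z)" for g :: "'a \<Rightarrow>\<^sub>L real"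
    by (rule linearI) (auto simp: blinfun.add_right blinfun.scaleR_right algebra_simps)
  have "\<exists>c. (\<forall>g\<in>G. 0 \<le> c g) \<and>
    (\<forall>z. blinfun_apply f (fst z) - snd z = (\<Sum>g\<in>G. c g * (blinfun_apply g (fst z) - snd z)))"
  proof (rule farkas[OF \<open>finite G\<close> lin lin])
    show "blinfun_apply f (fst z) - snd z \<le> 0"
      if "\<And>g. g \<in> G \<Longrightarrow> blinfun_apply g (fst z) - snd z \<le> 0" for z
      using le[of "fst z"] that by force
  qed
  then obtain c where c: "\<And>g. g \<in> G \<Longrightarrow> 0 \<le> c g"
    and eq: "\<And>v s. blinfun_apply f v - s = (\<Sum>g\<in>G. c g * (blinfun_apply g v - s))"
    by (metis fst_conv snd_conv)
  have "sum c G = 1" using eq[of 0 "-1"] by simp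
  moreover have "f = (\<Sum>g\<in>G. c g *\<^sub>R g)"
    by (rule blinfun_eqI) (use eq[of _ 0] in \<open>simp add: blinfun.sum_left blinfun.scaleR_left\<close>)
  ultimately show ?thesis
    using c \<open>finite G\<close> by (auto simp: convex_hull_finite)
qed

section \<open>Bounded polyhedra are polytopes\<close>

lemma convex_hull_Union_polytopes:
  assumes "finite \<F>" "\<And>P. P \<in> \<F> \<Longrightarrow> polytope P"
  shows "polytope (convex hull (\<Union>\<F>))"
proof -
  obtain V where V: "\<And>P. P \<in> \<F> \<Longrightarrow> finite (V P) \<and> P = convex hull (V P)"
    using assms(2) unfolding polytope_def by metis
  have "convex hull (\<Union>\<F>) = convex hull (\<Union>P\<in>\<F>. V P)"
  proof (rule antisym)
    have "P \<subseteq> convex hull (\<Union>P\<in>\<F>. V P)" if "P \<in> \<F>" for P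
    proof -
      have "convex hull (V P) \<subseteq> convex hull (\<Union>P\<in>\<F>. V P)"
        using that by (intro hull_mono) auto
      then show ?thesis using V[OF that] by simp
    qed
    then show "convex hull (\<Union>\<F>) \<subseteq> convex hull (\<Union>P\<in>\<F>. V P)"
      by (intro hull_minimal) auto
    have "V P \<subseteq> P" if "P \<in> \<F>" for P
      using V[OF that] hull_subset[of "V P" convex] by simp
    then show "convex hull (\<Union>P\<in>\<F>. V P) \<subseteq> convex hull (\<Union>\<F>)"
      by (intro hull_mono) blast
  qed
  moreover have "finite (\<Union>P\<in>\<F>. V P)" using assms(1) V by auto
  ultimately show ?thesis unfolding polytope_def by blast
qed

text \<open>Starting at a point of a polyhedron and moving along \<open>v\<close>, the first constraint to become tight
  is the one with the least ratio of slack to speed.\<close>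

lemma exit_face:
  fixes h :: "'i \<Rightarrow> 'a::real_vector \<Rightarrow> real"
  assumes "finite H" "\<And>i. i \<in> H \<Longrightarrow> linear (h i)" and x: "\<And>i. i \<in> H \<Longrightarrow> h i x \<le> b i"
    and v: "k \<in> H" "0 < h k v"
  shows "\<exists>t\<ge>0. \<exists>j\<in>H. 0 < h j v \<and> h j (x + t *\<^sub>R v) = b j \<and> (\<forall>i\<in>H. h i (x + t *\<^sub>R v) \<le> b i)"
proof -
  define E where "E = {i \<in> H. 0 < h i v}"
  define r where "r = (\<lambda>i. (b i - h i x) / h i v)"
  have E: "finite E" "E \<noteq> {}" using assms by (auto simp: E_def)
  obtain j where j: "j \<in> E" "\<And>i. i \<in> E \<Longrightarrow> r j \<le> r i"
    using arg_min_if_finite(1)[OF E, of r] arg_min_least[OF E, of _ r] by metis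
  have lin: "h i (x + t *\<^sub>R v) = h i x + t * h i v" if "i \<in> H" for i t
    using assms(2)[OF that] by (simp add: linear_add linear_scale)
  have r0: "0 \<le> r j" using j x by (auto simp: r_def E_def)
  have "h i (x + r j *\<^sub>R v) \<le> b i" if i: "i \<in> H" for i
  proof -
    show "h i (x + r j *\<^sub>R v) \<le> b i"
    proof (cases "i \<in> E")
      case True
      then have "r j * h i v \<le> r i * h i v"
        using j(2) by (intro mult_right_mono) (auto simp: E_def)
      also have "r i * h i v = b i - h i x" using True by (simp add: r_def E_def)
      finally show ?thesis using lin[OF i] by simp
    next
      case False
      then have "r j * h i v \<le> 0" using r0 i by (auto simp: E_def mult_nonneg_nonpos)
      then show ?thesis using lin[OF i, of "r j"] x[OF i] by simp
    qed
  qed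
  moreover have "j \<in> H" "0 < h j v" using j by (auto simp: E_def)
  moreover from this have "h j (x + r j *\<^sub>R v) = b j" using lin[of j "r j"] by (simp add: r_def)
  ultimately show ?thesis using r0 by blast
qed

text \<open>Induction on the number of constraints that are not forced to be tight.  A face that is not a
  single point contains, through each of its points, a segment along some direction \<open>v\<close>; as there are no rays,
  both ends of the segment lie on smaller faces.  So each face is the convex hull of
  finitely many smaller faces.  The argument is purely algebraic, so it applies in a
  subspace of an arbitrary vector space.\<close>

lemma polyhedron_without_rays_polytope:
  fixes h :: "'i \<Rightarrow> 'a::real_vector \<Rightarrow> real"
  assumes S: "subspace S" and H: "finite H" "\<And>i. i \<in> H \<Longrightarrow> linear (h i)"
    and pos: "\<And>v. v \<in> S \<Longrightarrow> v \<noteq> 0 \<Longrightarrow> \<exists>i\<in>H. 0 < h i v"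
  shows "polytope {x \<in> S. \<forall>i\<in>H. h i x \<le> b i}"
proof -
  define F where "F = (\<lambda>Z. {x \<in> S. (\<forall>i\<in>H. h i x \<le> b i) \<and> (\<forall>i\<in>Z. h i x = b i)})"
  have lin: "h i (x + t *\<^sub>R v) = h i x + t * h i v" if "i \<in> H" for i t x v
    using H(2)[OF that] by (simp add: linear_add linear_scale)
  have convF: "convex (F Z)" if "Z \<subseteq> H" for Z
  proof (rule convexI)
    fix x y and s t :: real
    assume xy: "x \<in> F Z" "y \<in> F Z" and st: "0 \<le> s" "0 \<le> t" "s + t = 1"
    have e: "h i (s *\<^sub>R x + t *\<^sub>R y) = s * h i x + t * h i y" if "i \<in> H" for i
      using H(2)[OF that] by (simp add: linear_add linear_scale)
    have "s * h i x + t * h i y \<le> b i" if "i \<in> H" for i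
      using xy that st by (intro convex_bound_le) (auto simp: F_def)
    moreover have "s * h i x + t * h i y = b i" if "i \<in> Z" for i
      using xy that st by (simp add: F_def flip: distrib_right)
    ultimately show "s *\<^sub>R x + t *\<^sub>R y \<in> F Z"
      using xy e that S by (auto simp: F_def subspace_add subspace_scale)
  qed
  have "polytope (F Z)" if "Z \<subseteq> H" "card (H - Z) = n" for Z n
    using that
  proof (induction n arbitrary: Z rule: less_induct)
    case (less n)
    show ?case
    proof (cases "\<exists>v\<in>S. v \<noteq> 0 \<and> (\<forall>i\<in>Z. h i v = 0)")
      case False
      \<comment> \<open>the tight constraints determine the point\<close>
      have eq: "x = y" if "x \<in> F Z" "y \<in> F Z" for x y
      proof (rule ccontr)
        assume "x \<noteq> y"
        moreover have "x - y \<in> S" using that S by (auto simp: F_def subspace_diff)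
        moreover have "h i (x - y) = 0" if "i \<in> Z" for i
          using \<open>x \<in> F Z\<close> \<open>y \<in> F Z\<close> that less.prems(1) H(2)[of i] by (auto simp: F_def linear_diff)
        ultimately show False using False by force
      qed
      have "F Z = {} \<or> (\<exists>x. F Z = {x})" using eq by blast
      then show ?thesis by (auto simp: polytope_empty polytope_sing)
    next
      case True
      then obtain v where v: "v \<in> S" "v \<noteq> 0" "\<And>i. i \<in> Z \<Longrightarrow> h i v = 0" by blast
      let ?\<F> = "(\<lambda>j. F (insert j Z)) ` (H - Z)"
      have reach: "\<exists>t j. 0 \<le> t \<and> j \<in> H - Z \<and> x + t *\<^sub>R w \<in> F (insert j Z)"
        if x: "x \<in> F Z" and w: "w \<in> S" "w \<noteq> 0" "\<And>i. i \<in> Z \<Longrightarrow> h i w = 0" for x w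
      proof -
        obtain k where k: "k \<in> H" "0 < h k w" using pos w by blast
        have xb: "\<And>i. i \<in> H \<Longrightarrow> h i x \<le> b i" using x by (auto simp: F_def)
        obtain t j where tj: "0 \<le> t" "j \<in> H" "0 < h j w" "h j (x + t *\<^sub>R w) = b j"
          "\<forall>i\<in>H. h i (x + t *\<^sub>R w) \<le> b i"
          using exit_face[where h=h and b=b and x=x and v=w, OF H xb k] by blast
        have "j \<notin> Z" using tj(3) w(3) by force
        moreover have "h i (x + t *\<^sub>R w) = b i" if "i \<in> Z" for i
          using lin[of i x t w] w(3)[OF that] x that less.prems(1) by (auto simp: F_def)
        ultimately show ?thesis
          using tj x w(1) S by (intro exI[of _ t] exI[of _ j]) (auto simp: F_def subspace_add subspace_scale)
      qed
      have "F Z = convex hull (\<Union>?\<F>)"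
      proof (rule antisym)
        show "convex hull (\<Union>?\<F>) \<subseteq> F Z"
          using less.prems(1) by (intro hull_minimal convF) (auto simp: F_def)
        show "F Z \<subseteq> convex hull (\<Union>?\<F>)"
        proof
          fix x assume x: "x \<in> F Z"
          obtain s i where s: "0 \<le> s" "i \<in> H - Z" "x + s *\<^sub>R v \<in> F (insert i Z)"
            using reach[OF x v] by blast
          have "h j (- v) = 0" if "j \<in> Z" for j
            using v(3)[OF that] that less.prems(1) H(2)[of j] by (auto simp: linear_neg)
          then obtain t j where t: "0 \<le> t" "j \<in> H - Z" "x + t *\<^sub>R (- v) \<in> F (insert j Z)"
            using reach[OF x, of "- v"] v S by (auto simp: subspace_neg)
          have a: "x + s *\<^sub>R v \<in> convex hull (\<Union>?\<F>)" and b: "x + t *\<^sub>R (- v) \<in> convex hull (\<Union>?\<F>)"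
            using s t by (blast intro: hull_inc)+
          show "x \<in> convex hull (\<Union>?\<F>)"
          proof (cases "s + t = 0")
            case True
            then have "s = 0" using s t by simp
            then show ?thesis using a by simp
          next
            case False
            then have st: "0 < s + t" using s t by simp
            have "(t / (s + t)) *\<^sub>R (x + s *\<^sub>R v) + (s / (s + t)) *\<^sub>R (x + t *\<^sub>R (- v))
              = (t / (s + t) + s / (s + t)) *\<^sub>R x"
              by (simp add: algebra_simps)
            also have "\<dots> = x" using st by (simp flip: add_divide_distrib add: add.commute)
            finally have "(t / (s + t)) *\<^sub>R (x + s *\<^sub>R v) + (s / (s + t)) *\<^sub>R (x + t *\<^sub>R (- v)) = x" .
            moreover have "(t / (s + t)) *\<^sub>R (x + s *\<^sub>R v) + (s / (s + t)) *\<^sub>R (x + t *\<^sub>R (- v)) \<in> convex hull (\<Union>?\<F>)"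
              using st s t by (intro convexD[OF convex_convex_hull a b]) (auto simp flip: add_divide_distrib)
            ultimately show ?thesis by simp
          qed
        qed
      qed
      moreover have "polytope P" if "P \<in> ?\<F>" for P
      proof -
        obtain j where j: "j \<in> H - Z" "P = F (insert j Z)" using \<open>P \<in> ?\<F>\<close> by blast
        have "H - insert j Z \<subset> H - Z" using j(1) by blast
        then have "card (H - insert j Z) < n"
          using psubset_card_mono[of "H - Z"] H(1) less.prems(2) by auto
        then show ?thesis using less.IH less.prems(1) j by blast
      qed
      ultimately show ?thesis using convex_hull_Union_polytopes[of ?\<F>] H(1) by simp
    qed
  qed
  from this[of "{}"] show ?thesis by (simp add: F_def)
qed

section \<open>Finite-dimensional subspaces\<close>

text \<open>Bounded closed parts of finite-dimensional subspaces are compact.  When a vector \<open>b\<close> is added to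
  the span, its coefficient is controlled by the distance of \<open>b\<close> from the old span, which is positive since
  the old span is closed by the induction hypothesis.\<close>

lemma compact_span_cball:
  fixes B :: "'a::real_normed_vector set"
  assumes "finite B"
  shows "compact (span B \<inter> cball 0 R)"
  using assms
proof (induction B arbitrary: R rule: finite_induct)
  case empty
  have "span {} \<inter> cball (0::'a) R = (if 0 \<le> R then {0} else {})" by auto
  then show ?case by simp
next
  case (insert b B)
  show ?case
  proof (cases "b \<in> span B")
    case True
    then show ?thesis using insert.IH by (simp add: span_redundant)
  next
    case False
    have clos: "closed (span B)"
      unfolding closed_sequential_limits
    proof (intro allI impI, elim conjE)
      fix y l assume y: "\<forall>n. y n \<in> span B" "y \<longlonglongrightarrow> l"
      obtain M where "\<And>n. norm (y n) \<le> M"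
        using convergent_imp_Bseq[of y] y(2) by (auto simp: convergent_def Bseq_def)
      then have "\<forall>n. y n \<in> span B \<inter> cball 0 M" using y(1) by auto
      then have "l \<in> span B \<inter> cball 0 M"
        using compact_imp_closed[OF insert.IH[of M]] y(2) unfolding closed_sequential_limits by blast
      then show "l \<in> span B" by simp
    qed
    define d where "d = infdist b (span B)"
    have d: "0 < d"
      using in_closed_iff_infdist_zero[OF clos, of b] False span_zero[of B] infdist_nonneg[of b "span B"]
      unfolding d_def by (metis empty_iff less_eq_real_def)
    have coeff: "\<bar>c\<bar> * d \<le> norm (s + c *\<^sub>R b)" if "s \<in> span B" for s c
    proof (cases "c = 0")
      case False
      have "- ((1/c) *\<^sub>R s) \<in> span B" using that by (intro span_neg span_scale)
      then have "d \<le> norm (b + (1/c) *\<^sub>R s)"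
        using infdist_le[of "- ((1/c) *\<^sub>R s)" "span B" b] by (simp add: d_def dist_norm)
      then have "\<bar>c\<bar> * d \<le> norm (c *\<^sub>R (b + (1/c) *\<^sub>R s))" by (simp add: mult_left_mono)
      also have "c *\<^sub>R (b + (1/c) *\<^sub>R s) = s + c *\<^sub>R b" using False by (simp add: algebra_simps)
      finally show ?thesis .
    qed simp
    define K where "K = {s + z |s z. s \<in> span B \<inter> cball 0 (R + R / d * norm b) \<and> z \<in> (\<lambda>c. c *\<^sub>R b) ` {- (R/d) .. R/d}}"
    have "compact K"
      unfolding K_def
      by (intro compact_sums insert.IH compact_continuous_image continuous_intros compact_Icc)
    moreover have "span (insert b B) \<inter> cball 0 R = K \<inter> cball 0 R"
    proof (intro antisym subsetI)
      fix x assume x: "x \<in> span (insert b B) \<inter> cball 0 R"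
      then obtain c where "x - c *\<^sub>R b \<in> span B" by (auto simp: span_insert)
      define s where "s = x - c *\<^sub>R b"
      have s: "s \<in> span B" "x = s + c *\<^sub>R b" using \<open>x - c *\<^sub>R b \<in> span B\<close> by (auto simp: s_def)
      have "\<bar>c\<bar> * d \<le> R" using coeff[OF s(1), of c] x s(2) by auto
      then have c: "\<bar>c\<bar> \<le> R / d" using d by (simp add: pos_le_divide_eq)
      have "norm s \<le> norm x + \<bar>c\<bar> * norm b"
        unfolding s_def using norm_triangle_ineq4[of x "c *\<^sub>R b"] by simp
      also have "\<dots> \<le> R + R / d * norm b"
        using x c by (intro add_mono mult_right_mono) auto
      finally have "s \<in> span B \<inter> cball 0 (R + R / d * norm b)" using s(1) by simp
      moreover have "c \<in> {- (R/d) .. R/d}" using c by (auto simp: abs_le_iff)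
      ultimately show "x \<in> K \<inter> cball 0 R" using x s(2) unfolding K_def by blast
    next
      fix x assume "x \<in> K \<inter> cball 0 R"
      then obtain s c where "s \<in> span B" "x = s + c *\<^sub>R b" "x \<in> cball 0 R"
        unfolding K_def by blast
      then show "x \<in> span (insert b B) \<inter> cball 0 R"
        using span_mono[of B "insert b B"] span_base[of b "insert b B"]
        by (auto intro!: span_add span_scale)
    qed
    ultimately show ?thesis by (simp add: compact_Int_closed)
  qed
qed

section \<open>Absorbing convex sets in polyhedral cones\<close>

lemma convex_shrink:
  assumes "convex A" "0 \<in> A" "t *\<^sub>R v \<in> A" "0 \<le> s" "s \<le> t"
  shows "s *\<^sub>R v \<in> A"
proof (cases "t = 0")
  case False
  then have "(s/t) *\<^sub>R (t *\<^sub>R v) + (1 - s/t) *\<^sub>R 0 \<in> A"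
    using assms by (intro convexD) (auto simp: divide_le_eq_1)
  then show ?thesis using False by simp
qed (use assms in auto)

text \<open>By Baire's theorem some dilate of \<open>A\<close> contains a relatively open set around a point \<open>w\<close>.  As \<open>A\<close>
  also contains a positive multiple of \<open>- w\<close>, convexity moves this open set to the origin.\<close>

lemma absorbing_subspace:
  fixes A :: "'a::banach set"
  assumes A: "closed A" "convex A" and M: "closed M" "subspace M"
    and abs: "\<And>v. v \<in> M \<Longrightarrow> \<exists>t>0. t *\<^sub>R v \<in> A"
  shows "\<exists>\<epsilon>>0. \<forall>v\<in>M. norm v < \<epsilon> \<longrightarrow> v \<in> A"
proof -
  have zero: "0 \<in> A" using abs[OF subspace_0[OF M(2)]] by simp
  have abs': "\<exists>n. (1 / real (Suc n)) *\<^sub>R v \<in> A" if v: "v \<in> M" for v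
  proof -
    obtain t where t: "0 < t" "t *\<^sub>R v \<in> A" using abs[OF v] by blast
    obtain n where "1 / real (Suc n) < t" using t(1) reals_Archimedean[of t] by (auto simp: inverse_eq_divide)
    then have "(1 / real (Suc n)) *\<^sub>R v \<in> A"
      by (intro convex_shrink[OF A(2) zero t(2)]) (simp_all del: of_nat_Suc)
    then show ?thesis by blast
  qed
  define T where "T = (\<lambda>n. {v \<in> M. (1 / real (Suc n)) *\<^sub>R v \<in> A})"
  let ?X = "top_of_set M"
  have clT: "closedin ?X (T n)" for n
  proof -
    have "closed ((\<lambda>v. (1 / real (Suc n)) *\<^sub>R v) -` A)"
      by (rule closed_vimage[OF A(1)]) (intro continuous_on_scaleR continuous_on_const continuous_on_id)
    then have "closedin ?X (M \<inter> (\<lambda>v. (1 / real (Suc n)) *\<^sub>R v) -` A)"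
      by (rule closedin_closed_Int)
    moreover have "M \<inter> (\<lambda>v. (1 / real (Suc n)) *\<^sub>R v) -` A = T n" by (auto simp: T_def)
    ultimately show ?thesis by simp
  qed
  have "completely_metrizable_space ?X"
  proof (rule completely_metrizable_space_closedin)
    show "completely_metrizable_space (euclidean :: 'a topology)" by (rule completely_metrizable_space_euclidean)
    show "closedin euclidean M" using M(1) by simp
  qed
  moreover have "?X interior_of (\<Union>(range T)) \<noteq> {}"
  proof -
    have "\<Union>(range T) = M" using abs' unfolding T_def by blast
    moreover have "?X interior_of topspace ?X = topspace ?X" by (rule interior_of_topspace)
    ultimately show ?thesis using subspace_0[OF M(2)] by auto
  qed
  ultimately obtain n where "?X interior_of (T n) \<noteq> {}"
    using Baire_category_alt[of ?X "range T"] clT by auto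
  then obtain U w where U: "openin ?X U" "w \<in> U" "U \<subseteq> T n"
    unfolding interior_of_def by blast
  then obtain r where r: "0 < r" "ball w r \<inter> M \<subseteq> U"
    unfolding openin_contains_ball by blast
  have w: "w \<in> M" using U by (auto simp: T_def)
  obtain m where m: "(1 / real (Suc m)) *\<^sub>R (- w) \<in> A" using abs' subspace_neg[OF M(2) w] by blast
  define a b where "a = 1 / real (Suc n)" and "b = 1 / real (Suc m)"
  have ab: "0 < a" "0 < b" by (auto simp: a_def b_def)
  have bA: "b *\<^sub>R (- w) \<in> A" using m by (simp add: b_def)
  have sum1: "b / (a + b) + a / (a + b) = 1" using ab by (simp flip: add_divide_distrib)
  define \<epsilon> where "\<epsilon> = b / (a + b) * a * r"
  show ?thesis
  proof (intro exI[of _ \<epsilon>] conjI ballI impI)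
    show "0 < \<epsilon>" using ab r by (simp add: \<epsilon>_def)
    fix v assume v: "v \<in> M" "norm v < \<epsilon>"
    define k where "k = b / (a + b) * a"
    have k: "0 < k" "\<epsilon> = k * r" using ab by (auto simp: k_def \<epsilon>_def)
    define z where "z = (1/k) *\<^sub>R v"
    have "norm z < r" using v k by (simp add: z_def field_simps)
    then have "w + z \<in> ball w r \<inter> M"
      using v M w by (auto simp: z_def dist_norm subspace_add subspace_scale)
    then have "a *\<^sub>R (w + z) \<in> A" using r U by (auto simp: T_def a_def)
    then have "(b / (a + b)) *\<^sub>R (a *\<^sub>R (w + z)) + (a / (a + b)) *\<^sub>R (b *\<^sub>R (- w)) \<in> A"
      using ab sum1 by (intro convexD[OF A(2) _ bA]) auto
    also have "(b / (a + b)) *\<^sub>R (a *\<^sub>R (w + z)) + (a / (a + b)) *\<^sub>R (b *\<^sub>R (- w)) = k *\<^sub>R z"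
      by (simp add: k_def algebra_simps)
    also have "\<dots> = v" using k by (simp add: z_def)
    finally show "v \<in> A" .
  qed
qed

text \<open>The opposite of a point of a cone need not belong to the cone, so the translation to the origin
  by convexity is only available when the cone is a subspace.  Otherwise some \<open>e\<close> in the cone has \<open>h e > 0\<close>
  for one of the functionals \<open>h\<close>.  Each \<open>v\<close> in the cone is the sum of a multiple of \<open>e\<close>, of size at most a
  constant times the norm of \<open>v\<close>, and a vector \<open>v'\<close> on a facet of the cone; the facets have fewer inequalities
  and are treated by induction.  Then \<open>v\<close> is the midpoint of two small vectors of \<open>A\<close>.\<close>

lemma absorbing_polyhedral_cone:
  fixes A :: "'a::banach set" and G :: "('a \<Rightarrow>\<^sub>L real) set"
  assumes A: "closed A" "convex A" and "closed M" "subspace M" "finite G"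
    and "\<And>v. v \<in> M \<Longrightarrow> (\<And>g. g \<in> G \<Longrightarrow> 0 \<le> blinfun_apply g v) \<Longrightarrow> \<exists>t>0. t *\<^sub>R v \<in> A"
  shows "\<exists>\<epsilon>>0. \<forall>v\<in>M. (\<forall>g\<in>G. 0 \<le> blinfun_apply g v) \<longrightarrow> norm v < \<epsilon> \<longrightarrow> v \<in> A"
  using assms(3-)
proof (induction "card G" arbitrary: G M rule: less_induct)
  case less
  note M = \<open>closed M\<close> \<open>subspace M\<close> and G = \<open>finite G\<close>
  define K where "K = {v \<in> M. \<forall>g\<in>G. 0 \<le> blinfun_apply g v}"
  have abs: "\<exists>t>0. t *\<^sub>R v \<in> A" if "v \<in> K" for v
    using that less.prems(4) by (auto simp: K_def)
  have closed_ker: "closed {v. blinfun_apply g v = 0}" for g :: "'a \<Rightarrow>\<^sub>L real"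
    by (intro closed_Collect_eq linear_continuous_on blinfun.bounded_linear_right continuous_on_const)
  have "\<exists>\<epsilon>>0. \<forall>v\<in>K. norm v < \<epsilon> \<longrightarrow> v \<in> A"
  proof (cases "\<forall>v\<in>K. \<forall>g\<in>G. blinfun_apply g v = 0")
    case True
    have K: "K = M \<inter> (\<Inter>g\<in>G. {v. blinfun_apply g v = 0})"
    proof
      have "K \<subseteq> M" unfolding K_def by blast
      then show "K \<subseteq> M \<inter> (\<Inter>g\<in>G. {v. blinfun_apply g v = 0})" using True by blast
      show "M \<inter> (\<Inter>g\<in>G. {v. blinfun_apply g v = 0}) \<subseteq> K" by (auto simp: K_def)
    qed
    have "closed K" unfolding K using M closed_ker by (intro closed_Int closed_INT) auto
    moreover have "subspace K"
      unfolding K using M(2)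
      by (auto simp: subspace_def blinfun.add_right blinfun.scaleR_right)
    ultimately show ?thesis using absorbing_subspace[OF A] abs by blast
  next
    case False
    then obtain e h where e: "e \<in> K" "h \<in> G" "0 < blinfun_apply h e"
      by (force simp: K_def)
    have "\<exists>\<epsilon>>0. \<forall>v\<in>K. blinfun_apply j v = 0 \<longrightarrow> norm v < \<epsilon> \<longrightarrow> v \<in> A" if j: "j \<in> G" for j
    proof -
      let ?M = "M \<inter> {v. blinfun_apply j v = 0}"
      have "\<exists>\<epsilon>>0. \<forall>v\<in>?M. (\<forall>g\<in>G - {j}. 0 \<le> blinfun_apply g v) \<longrightarrow> norm v < \<epsilon> \<longrightarrow> v \<in> A"
      proof (rule less.hyps)
        show "card (G - {j}) < card G" using j G by (rule card_Diff1_less[rotated])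
        show "closed ?M" using M closed_ker by auto
        show "subspace ?M" using M(2) by (auto simp: subspace_def blinfun.add_right blinfun.scaleR_right)
        show "finite (G - {j})" using G by simp
        fix v assume v: "v \<in> ?M" "\<And>g. g \<in> G - {j} \<Longrightarrow> 0 \<le> blinfun_apply g v"
        then have "v \<in> K" by (force simp: K_def)
        then show "\<exists>t>0. t *\<^sub>R v \<in> A" by (rule abs)
      qed
      then show ?thesis by (auto simp: K_def)
    qed
    then obtain \<epsilon>f where \<epsilon>f: "\<And>j. j \<in> G \<Longrightarrow> 0 < \<epsilon>f j"
      "\<And>j v. j \<in> G \<Longrightarrow> v \<in> K \<Longrightarrow> blinfun_apply j v = 0 \<Longrightarrow> norm v < \<epsilon>f j \<Longrightarrow> v \<in> A"
      by metis
    define \<epsilon>0 where "\<epsilon>0 = Min (\<epsilon>f ` G)"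
    have "\<epsilon>0 \<in> \<epsilon>f ` G" unfolding \<epsilon>0_def using G e(2) by (intro Min_in) auto
    then have \<epsilon>0: "0 < \<epsilon>0" "\<And>j. j \<in> G \<Longrightarrow> \<epsilon>0 \<le> \<epsilon>f j"
      using G \<epsilon>f(1) by (auto simp: \<epsilon>0_def)
    obtain \<tau> where \<tau>: "0 < \<tau>" "\<tau> *\<^sub>R e \<in> A" using abs e by blast
    have "0 \<in> K" using M(2) by (simp add: K_def subspace_0)
    then have zero: "0 \<in> A" using abs by fastforce
    define c where "c = norm h / blinfun_apply h e"
    have c: "0 \<le> c" using e by (simp add: c_def)
    define \<epsilon> where "\<epsilon> = min (\<tau> / (2 * c + 1)) (\<epsilon>0 / (2 * (1 + c * norm e)))"
    have pos: "0 < 2 * c + 1" "0 < 2 * (1 + c * norm e)"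
      using c by (auto intro: add_pos_nonneg)
    show ?thesis
    proof (intro exI[of _ \<epsilon>] conjI ballI impI)
      show "0 < \<epsilon>" using \<tau> \<epsilon>0 pos by (simp add: \<epsilon>_def)
      fix v assume v: "v \<in> K" "norm v < \<epsilon>"
      \<comment> \<open>move from \<open>v\<close> in the direction \<open>- e\<close> until a facet of the cone is reached\<close>
      have lin: "linear (\<lambda>x. - blinfun_apply g x)" for g :: "'a \<Rightarrow>\<^sub>L real"
        by (rule linearI) (auto simp: blinfun.add_right blinfun.scaleR_right)
      have vb: "- blinfun_apply g v \<le> 0" if "g \<in> G" for g using v that by (auto simp: K_def)
      have eh: "0 < - blinfun_apply h (- e)" using e by (simp add: blinfun.minus_right)
      obtain t j where tj: "0 \<le> t" "j \<in> G" "- blinfun_apply j (v + t *\<^sub>R (- e)) = 0"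
        "\<forall>g\<in>G. - blinfun_apply g (v + t *\<^sub>R (- e)) \<le> 0"
        using exit_face[where h="\<lambda>g x. - blinfun_apply g x" and b="\<lambda>_. 0" and x=v and v="- e",
            OF G lin vb e(2) eh] by blast
      define v' where "v' = v - t *\<^sub>R e"
      have v': "v' \<in> K" "blinfun_apply j v' = 0"
        using tj v e M(2) by (auto simp: v'_def K_def subspace_diff subspace_scale)
      have "0 \<le> blinfun_apply h v'" using v'(1) e(2) by (auto simp: K_def)
      then have "t * blinfun_apply h e \<le> blinfun_apply h v"
        by (simp add: v'_def blinfun.diff_right blinfun.scaleR_right)
      also have "\<dots> \<le> norm h * norm v" using norm_blinfun[of h v] by simp
      finally have t: "t \<le> c * norm v" using e by (simp add: c_def pos_le_divide_eq)
      have "(2 * c + 1) * norm v \<le> \<tau>"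
        using v pos by (simp add: \<epsilon>_def pos_less_divide_eq mult.commute)
      moreover have "(2 * c + 1) * norm v = 2 * (c * norm v) + norm v" by (simp add: algebra_simps)
      ultimately have "2 * t \<le> \<tau>" using t norm_ge_zero[of v] by linarith
      then have "(2 * t) *\<^sub>R e \<in> A" using convex_shrink[OF A(2) zero \<tau>(2)] tj(1) by simp
      moreover have "2 *\<^sub>R v' \<in> A"
      proof (rule \<epsilon>f(2)[OF tj(2)])
        show "2 *\<^sub>R v' \<in> K" using v'(1) M(2) by (auto simp: K_def subspace_scale blinfun.scaleR_right)
        show "blinfun_apply j (2 *\<^sub>R v') = 0" using v' by (simp add: blinfun.scaleR_right)
        have "norm v' \<le> norm v + t * norm e"
          unfolding v'_def using norm_triangle_ineq4[of v "t *\<^sub>R e"] tj(1) by simp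
        also have "\<dots> \<le> norm v + (c * norm v) * norm e" using t by (intro add_mono mult_right_mono) auto
        finally have "2 * norm v' \<le> norm v * (2 * (1 + c * norm e))" by (simp add: algebra_simps)
        also have "\<dots> < \<epsilon>0" using v pos by (simp add: \<epsilon>_def pos_less_divide_eq)
        finally show "norm (2 *\<^sub>R v') < \<epsilon>f j" using \<epsilon>0(2)[OF tj(2)] by simp
      qed
      ultimately have "(1/2) *\<^sub>R (2 *\<^sub>R v') + (1/2) *\<^sub>R ((2 * t) *\<^sub>R e) \<in> A"
        by (intro convexD[OF A(2)]) auto
      then show "v \<in> A" by (simp add: v'_def)
    qed
  qed
  then show ?case unfolding K_def by blast
qed

section \<open>Rays and interiors\<close>

lemma eventually_nhds_along_ray:
  fixes x :: "'a::real_normed_vector"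
  assumes "\<forall>\<^sub>F y in nhds x. P y"
  obtains t where "0 < t" "t < 1" "P (x + t *\<^sub>R v)"
proof -
  have "((\<lambda>t. x + t *\<^sub>R v) \<longlongrightarrow> x + 0 *\<^sub>R v) (at_right (0::real))"
    by (intro tendsto_intros)
  then have "\<forall>\<^sub>F t in at_right (0::real). P (x + t *\<^sub>R v)"
    using eventually_compose_filterlim[OF assms] by simp
  moreover have "\<forall>\<^sub>F t in at_right (0::real). t \<in> {0<..<1}"
    by (rule eventually_at_right_real) simp
  ultimately have "\<forall>\<^sub>F t in at_right (0::real). P (x + t *\<^sub>R v) \<and> t \<in> {0<..<1}"
    by (rule eventually_conj)
  then obtain t where t: "P (x + t *\<^sub>R v)" "t \<in> {0<..<1}"
    using eventually_happens'[OF trivial_limit_at_right_real] by blast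
  show thesis using t by (intro that[of t]) auto
qed

lemma convex_interior_shrink:
  fixes S :: "'a::real_normed_vector set"
  assumes "convex S" "c \<in> interior S" "x \<in> S" "0 < s" "s \<le> 1"
  shows "x + s *\<^sub>R (c - x) \<in> interior S"
proof -
  obtain e where e: "0 < e" "ball c e \<subseteq> S" using assms(2) by (auto simp: mem_interior)
  have "ball (x + s *\<^sub>R (c - x)) (s * e) \<subseteq> S"
  proof
    fix y assume y: "y \<in> ball (x + s *\<^sub>R (c - x)) (s * e)"
    define z where "z = x + (1/s) *\<^sub>R (y - x)"
    have "s *\<^sub>R (z - c) = y - (x + s *\<^sub>R (c - x))" using assms(4) by (simp add: z_def algebra_simps)
    then have "s * norm (z - c) = norm (y - (x + s *\<^sub>R (c - x)))"
      using assms(4) by (metis abs_of_pos norm_scaleR)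
    then have "s * norm (z - c) < s * e" using y by (simp add: dist_norm norm_minus_commute)
    then have "z \<in> S" using e assms(4) by (auto simp: dist_norm norm_minus_commute)
    then have "(1 - s) *\<^sub>R x + s *\<^sub>R z \<in> S" using assms by (intro convexD) auto
    then show "y \<in> S" using assms(4) by (simp add: z_def algebra_simps)
  qed
  then show ?thesis using e assms(4) by (auto simp: mem_interior intro!: exI[of _ "s * e"])
qed

section \<open>Equivalent norms, norming functionals and support cones\<close>

lemma equivalent_norm_sublinear: "equivalent_norm N \<Longrightarrow> sublinear N"
  by (auto simp: equivalent_norm_def is_norm_def sublinear_def)

lemma equivalent_norm_scale: "equivalent_norm N \<Longrightarrow> N (r *\<^sub>R x) = \<bar>r\<bar> * N x"
  and equivalent_norm_triangle: "equivalent_norm N \<Longrightarrow> N (x + y) \<le> N x + N y"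
  and equivalent_norm_nonneg: "equivalent_norm N \<Longrightarrow> 0 \<le> N x"
  and equivalent_norm_eq_0_iff: "equivalent_norm N \<Longrightarrow> N x = 0 \<longleftrightarrow> x = 0"
  by (auto simp: equivalent_norm_def is_norm_def)

lemma equivalent_norm_minus: "equivalent_norm N \<Longrightarrow> N (- x) = N x"
  using equivalent_norm_scale[of N "- 1" x] by simp

lemma equivalent_norm_pos: "equivalent_norm N \<Longrightarrow> x \<noteq> 0 \<Longrightarrow> 0 < N x"
  using equivalent_norm_nonneg[of N x] equivalent_norm_eq_0_iff[of N x] by linarith

lemma equivalent_norm_continuous:
  assumes N: "equivalent_norm N"
  shows "continuous_on UNIV N"
proof -
  obtain C where C: "0 < C" "\<And>x. N x \<le> C * norm x"
    using N unfolding equivalent_norm_def by blast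
  have le: "N x - N y \<le> C * norm (x - y)" for x y
    using equivalent_norm_triangle[OF N, of "x - y" y] C(2)[of "x - y"] by simp
  have "C-lipschitz_on UNIV N"
  proof (rule lipschitz_onI)
    show "dist (N x) (N y) \<le> C * dist x y" for x y
      using le[of x y] le[of y x] by (auto simp: dist_norm norm_minus_commute)
  qed (use C in simp)
  then show ?thesis by (rule lipschitz_on_continuous_on)
qed

lemma linear_blinfun_apply: "linear (blinfun_apply g)"
  by (simp add: blinfun.bounded_linear_right bounded_linear.linear)

lemma blinfun_continuous: "continuous_on S (blinfun_apply g)"
  by (intro linear_continuous_on blinfun.bounded_linear_right)

lemma linear_minorant_blinfun:
  assumes N: "equivalent_norm N" and f: "linear f" "\<And>u. f u \<le> N u"
  obtains g where "blinfun_apply g = f"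
proof -
  obtain C where C: "\<And>x. N x \<le> C * norm x"
    using N unfolding equivalent_norm_def by blast
  have "norm (f x) \<le> norm x * C" for x
    using f(2)[of x] f(2)[of "- x"] C[of x] linear_neg[OF f(1), of x] equivalent_norm_minus[OF N, of x]
    by (auto simp: mult.commute)
  then have "bounded_linear f"
    using f(1) by (intro bounded_linear_intro[where K=C]) (auto simp: linear_add linear_scale)
  then show thesis using that bounded_linear_Blinfun_apply by blast
qed

text \<open>In this form the results on linear minorants of sublinear functionals apply to norming
  functionals.\<close>

lemma norming_functionals_iff:
  assumes N: "equivalent_norm N" and x: "N x = 1"
  shows "f \<in> norming_functionals N x \<longleftrightarrow> (\<forall>y. blinfun_apply f y \<le> N y) \<and> blinfun_apply f x = 1"
proof
  assume f: "f \<in> norming_functionals N x"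
  obtain c where c: "0 < c" "\<And>x. c * norm x \<le> N x"
    using N unfolding equivalent_norm_def by blast
  have bdd: "bdd_above ((\<lambda>x. \<bar>blinfun_apply f x\<bar>) ` {x. N x \<le> 1})"
  proof (rule bdd_aboveI2)
    fix y assume "y \<in> {x. N x \<le> 1}"
    then have "norm y \<le> 1 / c" using c(2)[of y] c(1) by (simp add: pos_le_divide_eq mult.commute)
    then show "\<bar>blinfun_apply f y\<bar> \<le> norm f * (1 / c)"
      using norm_blinfun[of f y] mult_left_mono[of "norm y" "1/c" "norm f"] by simp
  qed
  have "blinfun_apply f y \<le> N y" for y
  proof (cases "y = 0")
    case False
    then have pos: "0 < N y" by (rule equivalent_norm_pos[OF N])
    then have "\<bar>blinfun_apply f ((1 / N y) *\<^sub>R y)\<bar> \<le> dual_norm N f"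
      unfolding dual_norm_def using equivalent_norm_scale[OF N, of "1 / N y" y]
      by (intro cSUP_upper[OF _ bdd]) simp
    also have "\<dots> = 1" using f by (simp add: norming_functionals_def)
    finally show ?thesis using pos by (simp add: blinfun.scaleR_right field_simps abs_le_iff)
  qed (use equivalent_norm_eq_0_iff[OF N, of 0] in simp)
  then show "(\<forall>y. blinfun_apply f y \<le> N y) \<and> blinfun_apply f x = 1"
    using f by (simp add: norming_functionals_def)
next
  assume f: "(\<forall>y. blinfun_apply f y \<le> N y) \<and> blinfun_apply f x = 1"
  have "\<bar>blinfun_apply f y\<bar> \<le> N y" for y
    using f[THEN conjunct1, rule_format, of y] f[THEN conjunct1, rule_format, of "- y"]
      equivalent_norm_minus[OF N, of y] by (simp add: blinfun.minus_right abs_le_iff)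
  then have le: "\<bar>blinfun_apply f y\<bar> \<le> 1" if "N y \<le> 1" for y
    using that order_trans by blast
  have "dual_norm N f = 1"
    unfolding dual_norm_def
  proof (rule cSup_eq_maximum)
    show "1 \<in> (\<lambda>x. \<bar>blinfun_apply f x\<bar>) ` {x. N x \<le> 1}"
      using f x by (intro image_eqI[of _ _ x]) auto
  qed (use le in auto)
  then show "f \<in> norming_functionals N x" using f by (simp add: norming_functionals_def)
qed

lemma convex_norming_functionals:
  assumes N: "equivalent_norm N" and x: "N x = 1"
  shows "convex (norming_functionals N x)"
proof (rule convexI)
  fix f g :: "'a \<Rightarrow>\<^sub>L real" and s t :: real
  assume fg: "f \<in> norming_functionals N x" "g \<in> norming_functionals N x"
    and st: "0 \<le> s" "0 \<le> t" "s + t = 1"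
  have "s * blinfun_apply f y + t * blinfun_apply g y \<le> N y" for y
    using fg st by (intro convex_bound_le) (auto simp: norming_functionals_iff[OF N x])
  then show "s *\<^sub>R f + t *\<^sub>R g \<in> norming_functionals N x"
    using fg st by (auto simp: norming_functionals_iff[OF N x] blinfun.add_left blinfun.scaleR_left)
qed

text \<open>For a functional \<open>f\<close> below \<open>N\<close> this is the cone over the face of the unit ball on which \<open>f\<close> takes
  the value \<open>1\<close>.  It is convex, although it is the set where two functions agree, because it is a
  sublevel set of \<open>N - f\<close>.\<close>

definition support_cone :: "('a::real_normed_vector \<Rightarrow> real) \<Rightarrow> ('a \<Rightarrow>\<^sub>L real) \<Rightarrow> 'a set" where
  "support_cone N f = {x. N x \<le> blinfun_apply f x}"

lemma closed_support_cone: "equivalent_norm N \<Longrightarrow> closed (support_cone N f)"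
  unfolding support_cone_def
  by (intro closed_Collect_le equivalent_norm_continuous blinfun_continuous)

lemma convex_support_cone:
  assumes N: "equivalent_norm N"
  shows "convex (support_cone N f)"
proof (rule convexI)
  fix u v and s t :: real
  assume uv: "u \<in> support_cone N f" "v \<in> support_cone N f" and st: "0 \<le> s" "0 \<le> t" "s + t = 1"
  have "N (s *\<^sub>R u + t *\<^sub>R v) \<le> s * N u + t * N v"
    using equivalent_norm_triangle[OF N, of "s *\<^sub>R u" "t *\<^sub>R v"] st
    by (simp add: equivalent_norm_scale[OF N])
  also have "\<dots> \<le> s * blinfun_apply f u + t * blinfun_apply f v"
    using uv st by (intro add_mono mult_left_mono) (auto simp: support_cone_def)
  finally show "s *\<^sub>R u + t *\<^sub>R v \<in> support_cone N f"
    by (simp add: support_cone_def blinfun.add_right blinfun.scaleR_right)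
qed

lemma support_cone_scale:
  assumes N: "equivalent_norm N" and "0 < s"
  shows "s *\<^sub>R x \<in> support_cone N f \<longleftrightarrow> x \<in> support_cone N f"
  using assms(2) by (simp add: support_cone_def equivalent_norm_scale[OF N] blinfun.scaleR_right)

section \<open>Locally polyhedral norms\<close>

definition locally_polyhedral :: "('a::real_normed_vector \<Rightarrow> real) \<Rightarrow> bool" where
  "locally_polyhedral N \<longleftrightarrow> (\<forall>x. N x = 1 \<longrightarrow>
     (\<exists>G :: ('a \<Rightarrow>\<^sub>L real) set. finite G \<and> (\<forall>g\<in>G. \<forall>y. blinfun_apply g y \<le> N y) \<and>
        (\<forall>\<^sub>F y in nhds x. \<exists>g\<in>G. N y = blinfun_apply g y)))"

text \<open>Finitely many of the neighbourhoods cover the compact sphere of the subspace, and their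
  functionals cut out its unit ball.  There are no rays, since \<open>N\<close> is positive away from the origin.\<close>

lemma locally_polyhedral_imp_K_polyhedral:
  assumes N: "equivalent_norm N" and lp: "locally_polyhedral N"
  shows "K_polyhedral N"
  unfolding K_polyhedral_def
proof (intro allI impI, elim conjE exE)
  fix S B :: "'a set" assume S: "subspace S" and B: "finite B" "S = span B"
  obtain c where c: "0 < c" "\<And>x. c * norm x \<le> N x"
    using N unfolding equivalent_norm_def by blast
  define K where "K = {x \<in> S. N x = 1}"
  have "N x = 1 \<Longrightarrow> norm x \<le> 1 / c" for x
    using c(2)[of x] c(1) by (simp add: pos_le_divide_eq mult.commute)
  then have "K = (S \<inter> cball 0 (1/c)) \<inter> {x. N x = 1}" by (auto simp: K_def)
  moreover have "closed {x. N x = 1}"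
    by (intro closed_Collect_eq equivalent_norm_continuous[OF N] continuous_on_const)
  ultimately have "compact K"
    using compact_span_cball[OF B(1), of "1/c"] B(2) by (simp add: compact_Int_closed)
  define good where "good = (\<lambda>x (G :: ('a \<Rightarrow>\<^sub>L real) set) U. finite G \<and>
    (\<forall>g\<in>G. \<forall>y. blinfun_apply g y \<le> N y) \<and> open U \<and> x \<in> U \<and> (\<forall>y\<in>U. \<exists>g\<in>G. N y = blinfun_apply g y))"
  have "\<exists>G U. good x G U" if "x \<in> K" for x
  proof -
    have "N x = 1" using that by (simp add: K_def)
    then obtain G :: "('a \<Rightarrow>\<^sub>L real) set" where G: "finite G" "\<forall>g\<in>G. \<forall>y. blinfun_apply g y \<le> N y"
        and ev: "\<forall>\<^sub>F y in nhds x. \<exists>g\<in>G. N y = blinfun_apply g y"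
      using lp unfolding locally_polyhedral_def by blast
    obtain U where "open U" "x \<in> U" "\<forall>y\<in>U. \<exists>g\<in>G. N y = blinfun_apply g y"
      using ev unfolding eventually_nhds by (elim exE conjE)
    with G show ?thesis unfolding good_def by (intro exI[of _ G] exI[of _ U] conjI)
  qed
  then obtain G U where good: "\<And>x. x \<in> K \<Longrightarrow> good x (G x) (U x)" by metis
  have GU: "finite (G x)" "\<And>g y. g \<in> G x \<Longrightarrow> blinfun_apply g y \<le> N y" "open (U x)" "x \<in> U x"
    "\<And>y. y \<in> U x \<Longrightarrow> \<exists>g\<in>G x. N y = blinfun_apply g y" if "x \<in> K" for x
    using good[OF that] unfolding good_def by blast+
  have "K \<subseteq> (\<Union>x\<in>K. U x)" using GU(4) by blast
  then obtain K' where K': "K' \<subseteq> K" "finite K'" "K \<subseteq> (\<Union>x\<in>K'. U x)"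
    using compactE_image[OF \<open>compact K\<close>, of K U] GU(3) by blast
  define H where "H = (\<Union>x\<in>K'. G x)"
  have H: "finite H" using K' GU(1) by (auto simp: H_def)
  have Hle: "blinfun_apply g y \<le> N y" if "g \<in> H" for g y
    using that K' GU(2) by (auto simp: H_def)
  have Heq: "\<exists>g\<in>H. N x = blinfun_apply g x" if x: "x \<in> S" "x \<noteq> 0" for x
  proof -
    have pos: "0 < N x" using x by (intro equivalent_norm_pos[OF N])
    define y where "y = (1 / N x) *\<^sub>R x"
    have y: "y \<in> K" "x = N x *\<^sub>R y"
      using pos x S by (auto simp: y_def K_def subspace_scale equivalent_norm_scale[OF N])
    then obtain g where g: "g \<in> H" "N y = blinfun_apply g y"
      using K'(1,3) GU(5) unfolding H_def by blast
    have "blinfun_apply g x = N x * blinfun_apply g y"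
      using blinfun.scaleR_right[of g "N x" y] y(2) by simp
    then have "N x = blinfun_apply g x" using g(2) y(1) by (simp add: K_def)
    then show ?thesis using g(1) by blast
  qed
  have "{x \<in> S. N x \<le> 1} = {x \<in> S. \<forall>g\<in>H. blinfun_apply g x \<le> 1}"
  proof (intro Collect_cong conj_cong refl)
    fix x assume x: "x \<in> S"
    show "N x \<le> 1 \<longleftrightarrow> (\<forall>g\<in>H. blinfun_apply g x \<le> 1)"
    proof (cases "x = 0")
      case True
      then show ?thesis using equivalent_norm_eq_0_iff[OF N, of 0] by simp
    next
      case False
      then show ?thesis using Heq[OF x] Hle by (metis order_trans)
    qed
  qed
  moreover have "polytope {x \<in> S. \<forall>g\<in>H. blinfun_apply g x \<le> 1}"
  proof (rule polyhedron_without_rays_polytope[OF S H linear_blinfun_apply])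
    fix v assume "v \<in> S" "v \<noteq> 0"
    then show "\<exists>g\<in>H. 0 < blinfun_apply g v" using Heq equivalent_norm_pos[OF N, of v] by force
  qed
  ultimately show "polytope {x \<in> S. N x \<le> 1}" by simp
qed

text \<open>A functional that stays strictly below \<open>N\<close> at \<open>x\<close> does so near \<open>x\<close> and can be discarded.\<close>

lemma locally_polyhedral_active:
  assumes N: "equivalent_norm N" and lp: "locally_polyhedral N" and x: "N x = 1"
  obtains G where "finite G" "\<And>g y. g \<in> G \<Longrightarrow> blinfun_apply g y \<le> N y"
    "\<And>g. g \<in> G \<Longrightarrow> blinfun_apply g x = 1" "\<forall>\<^sub>F y in nhds x. \<exists>g\<in>G. N y = blinfun_apply g y"
proof -
  obtain G :: "('a \<Rightarrow>\<^sub>L real) set" where G: "finite G"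
    and le: "\<forall>g\<in>G. \<forall>y. blinfun_apply g y \<le> N y"
    and ev: "\<forall>\<^sub>F y in nhds x. \<exists>g\<in>G. N y = blinfun_apply g y"
    using lp x unfolding locally_polyhedral_def by blast
  have "\<forall>\<^sub>F y in nhds x. \<forall>g\<in>{g \<in> G. blinfun_apply g x < 1}. blinfun_apply g y < N y"
  proof (rule eventually_ball_finite)
    show "\<forall>g\<in>{g \<in> G. blinfun_apply g x < 1}. \<forall>\<^sub>F y in nhds x. blinfun_apply g y < N y"
    proof
      fix g assume g: "g \<in> {g \<in> G. blinfun_apply g x < 1}"
      have "open {y. blinfun_apply g y < N y}"
        by (intro open_Collect_less equivalent_norm_continuous[OF N] blinfun_continuous)
      then show "\<forall>\<^sub>F y in nhds x. blinfun_apply g y < N y"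
        unfolding eventually_nhds using g x by (intro exI[of _ "{y. blinfun_apply g y < N y}"]) auto
    qed
  qed (use G in simp)
  with ev have "\<forall>\<^sub>F y in nhds x. \<exists>g\<in>{g \<in> G. blinfun_apply g x = 1}. N y = blinfun_apply g y"
  proof eventually_elim
    case (elim y)
    then obtain g where g: "g \<in> G" "N y = blinfun_apply g y" by blast
    then have "\<not> blinfun_apply g x < 1" using elim(2) by auto
    moreover have "blinfun_apply g x \<le> 1" using le g(1) x by metis
    ultimately show ?case using g by (intro bexI[of _ g]) auto
  qed
  then show thesis by (rule that[rotated -1]) (use G le in auto)
qed

text \<open>Moving a little from \<open>x\<close> in the direction \<open>v\<close> shows that a norming functional of \<open>x\<close> is, at each
  \<open>v\<close>, below some functional active at \<open>x\<close>.  By Farkas' lemma it is a convex combination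
  of the active ones, so it can be extreme only if it is one of them.\<close>

lemma locally_polyhedral_imp_Delta:
  assumes N: "equivalent_norm N" and lp: "locally_polyhedral N"
  shows "property_Delta N"
  unfolding property_Delta_def
proof (intro allI impI)
  fix x assume x: "N x = 1"
  obtain G where G: "finite G" "\<And>g y. g \<in> G \<Longrightarrow> blinfun_apply g y \<le> N y"
    "\<And>g. g \<in> G \<Longrightarrow> blinfun_apply g x = 1" "\<forall>\<^sub>F y in nhds x. \<exists>g\<in>G. N y = blinfun_apply g y"
    using locally_polyhedral_active[OF N lp x] by blast
  have sub: "convex hull G \<subseteq> norming_functionals N x"
    using G by (intro hull_minimal convex_norming_functionals[OF N x])
      (auto simp: norming_functionals_iff[OF N x])
  have "f \<in> G" if f: "f extreme_point_of norming_functionals N x" for f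
  proof -
    have fD: "\<And>y. blinfun_apply f y \<le> N y" "blinfun_apply f x = 1"
      using f by (auto simp: extreme_point_of_def norming_functionals_iff[OF N x])
    have "\<exists>g\<in>G. blinfun_apply f v \<le> blinfun_apply g v" for v
    proof -
      obtain t where t: "0 < t" "\<exists>g\<in>G. N (x + t *\<^sub>R v) = blinfun_apply g (x + t *\<^sub>R v)"
        using G(4) by (rule eventually_nhds_along_ray)
      then obtain g where g: "g \<in> G" "N (x + t *\<^sub>R v) = blinfun_apply g (x + t *\<^sub>R v)" by blast
      have "t * blinfun_apply f v \<le> t * blinfun_apply g v"
        using fD(1)[of "x + t *\<^sub>R v"] fD(2) G(3)[OF g(1)] g(2)
        by (simp add: blinfun.add_right blinfun.scaleR_right)
      then show ?thesis using t(1) g(1) by auto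
    qed
    then have "f \<in> convex hull G" by (rule le_Max_imp_convex_hull[OF G(1)])
    then have "f extreme_point_of convex hull G"
      using f sub unfolding extreme_point_of_def by blast
    then show ?thesis by (rule extreme_point_of_convex_hull)
  qed
  then have "{f. f extreme_point_of norming_functionals N x} \<subseteq> G" by blast
  then show "finite {f. f extreme_point_of norming_functionals N x}"
    using G(1) by (rule finite_subset)
qed

section \<open>Property Delta and polyhedrality make the norm locally polyhedral\<close>

text \<open>The functionals norming \<open>x\<close> are the linear minorants of the directional derivative at \<open>x\<close>, which
  is itself sublinear; so the extreme minorant that touches it at \<open>v\<close> is an extreme norming
  functional.\<close>

lemma extreme_functional_attains_dir_deriv:
  assumes N: "equivalent_norm N" and x: "N x = 1"
  obtains g where "g extreme_point_of norming_functionals N x" "blinfun_apply g v = dir_deriv N x v"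
proof -
  have sub: "sublinear N" by (rule equivalent_norm_sublinear[OF N])
  let ?p = "dir_deriv N x"
  obtain f where f: "linear f" "\<And>u. f u \<le> ?p u" "f v = ?p v"
    and ext: "\<And>g h c. \<lbrakk>linear g; linear h; \<forall>u. g u \<le> ?p u; \<forall>u. h u \<le> ?p u; 0 < c; c < 1;
       \<forall>u. f u = (1 - c) * g u + c * h u\<rbrakk> \<Longrightarrow> g = f \<and> h = f"
    using extreme_linear_minorant[OF dir_deriv_sublinear[OF sub], of x v] by blast
  have fN: "\<forall>u. f u \<le> N u" "f x = 1"
    using linear_le_dir_deriv_iff[OF sub f(1), of x] f(2) x by auto
  then obtain g where g: "blinfun_apply g = f"
    using linear_minorant_blinfun[OF N f(1)] by blast
  have norming_le: "\<forall>u. blinfun_apply h u \<le> ?p u" if "h \<in> norming_functionals N x" for h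
    using that linear_le_dir_deriv_iff[OF sub linear_blinfun_apply, of h x] x
    by (simp add: norming_functionals_iff[OF N x])
  have "g \<notin> open_segment a b" if ab: "a \<in> norming_functionals N x" "b \<in> norming_functionals N x" for a b
  proof
    assume "g \<in> open_segment a b"
    then obtain u where u: "a \<noteq> b" "0 < u" "u < 1" "g = (1 - u) *\<^sub>R a + u *\<^sub>R b"
      by (auto simp: in_segment)
    have "blinfun_apply a = f \<and> blinfun_apply b = f"
    proof (rule ext[OF linear_blinfun_apply linear_blinfun_apply norming_le[OF ab(1)] norming_le[OF ab(2)] u(2,3)])
      show "\<forall>y. f y = (1 - u) * blinfun_apply a y + u * blinfun_apply b y"
        unfolding g[symmetric] u(4) by (simp add: blinfun.add_left blinfun.scaleR_left)
    qed
    then show False using u(1) by (metis blinfun_apply_inject)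
  qed
  then have "g extreme_point_of norming_functionals N x"
    unfolding extreme_point_of_def using fN g by (simp add: norming_functionals_iff[OF N x])
  then show thesis using that g f(3) by simp
qed

text \<open>A two-dimensional argument: the tangent line to a polygon at \<open>x\<close> either contains an edge that starts at
  \<open>x\<close> in the direction \<open>w\<close>, or the polygon leaves this line at a positive angle.  A
  non-positive derivative along \<open>w\<close> excludes the second case.\<close>

lemma polytope_flat_direction:
  assumes N: "equivalent_norm N" and K: "K_polyhedral N" and x: "N x = 1"
    and g: "g \<in> norming_functionals N x" and w: "blinfun_apply g w = 0" "dir_deriv N x w \<le> 0"
  shows "\<exists>s>0. N (x + s *\<^sub>R w) \<le> 1"
proof (cases "w = 0")
  case True
  then show ?thesis using x by (intro exI[of _ 1]) simp
next
  case False
  have gN: "\<And>y. blinfun_apply g y \<le> N y" and gx: "blinfun_apply g x = 1"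
    using g by (auto simp: norming_functionals_iff[OF N x])
  define S where "S = span {x, w}"
  have S: "subspace S" "x \<in> S" "w \<in> S" by (auto simp: S_def span_base)
  have "polytope {y \<in> S. N y \<le> 1}"
  proof (rule K[unfolded K_polyhedral_def, rule_format], intro conjI exI)
    show "finite {x, w}" "S = span {x, w}" by (simp_all add: S_def)
  qed (rule S(1))
  then obtain V where V: "finite V" "{y \<in> S. N y \<le> 1} = convex hull V"
    unfolding polytope_def by blast
  have VS: "y \<in> S" "N y \<le> 1" if "y \<in> V" for y
    using hull_inc[OF that, of convex] V(2) by auto
  have "\<exists>b. y = blinfun_apply g y *\<^sub>R x + b *\<^sub>R w" if y: "y \<in> V" for y
  proof -
    obtain a b where ab: "y = a *\<^sub>R x + b *\<^sub>R w"
      using VS(1)[OF y] unfolding S_def by (auto simp: span_insert algebra_simps)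
    then have "blinfun_apply g y = a" using w gx by (simp add: blinfun.add_right blinfun.scaleR_right)
    then show ?thesis using ab by blast
  qed
  then obtain b where b: "\<And>y. y \<in> V \<Longrightarrow> y = blinfun_apply g y *\<^sub>R x + b y *\<^sub>R w" by metis
  show ?thesis
  proof (cases "\<exists>y\<in>V. blinfun_apply g y = 1 \<and> 0 < b y")
    case True
    then show ?thesis using b VS(2) by (metis scaleR_one)
  next
    case noflat: False
    \<comment> \<open>then the polygon lies below a line through \<open>x\<close> of finite slope, which makes \<open>N\<close> grow linearly along \<open>w\<close>\<close>
    \<comment> \<open>terms with \<open>g y = 1\<close> are divisions by zero and contribute \<open>0\<close>\<close>
    define M where "M = 1 + (\<Sum>y\<in>V. \<bar>b y\<bar> / (1 - blinfun_apply g y))"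
    have g1: "blinfun_apply g y \<le> 1" if "y \<in> V" for y
      using gN[of y] VS(2)[OF that] by simp
    have nonneg: "0 \<le> \<bar>b y\<bar> / (1 - blinfun_apply g y)" if "y \<in> V" for y
      using g1[OF that] by simp
    have "0 \<le> (\<Sum>y\<in>V. \<bar>b y\<bar> / (1 - blinfun_apply g y))" by (intro sum_nonneg nonneg)
    then have M: "0 < M" by (simp add: M_def)
    have slope: "b y \<le> M * (1 - blinfun_apply g y)" if y: "y \<in> V" for y
    proof (cases "blinfun_apply g y = 1")
      case True
      then show ?thesis using noflat y by force
    next
      case False
      then have pos: "0 < 1 - blinfun_apply g y" using g1[OF y] by simp
      have "\<bar>b y\<bar> / (1 - blinfun_apply g y) \<le> M"
        using member_le_sum[of y V "\<lambda>y. \<bar>b y\<bar> / (1 - blinfun_apply g y)"] y nonneg V(1)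
        by (simp add: M_def)
      then have "\<bar>b y\<bar> \<le> M * (1 - blinfun_apply g y)" using pos by (simp add: pos_divide_le_eq)
      then show ?thesis by simp
    qed
    define Q where "Q = {a *\<^sub>R x + c *\<^sub>R w | a c. c \<le> M * (1 - a)}"
    have "convex Q"
    proof (rule convexI)
      fix y z and s t :: real assume yz: "y \<in> Q" "z \<in> Q" and st: "0 \<le> s" "0 \<le> t" "s + t = 1"
      obtain a c a' c' where ac: "y = a *\<^sub>R x + c *\<^sub>R w" "c \<le> M * (1 - a)"
        "z = a' *\<^sub>R x + c' *\<^sub>R w" "c' \<le> M * (1 - a')" using yz unfolding Q_def by blast
      have "s * c + t * c' \<le> s * (M * (1 - a)) + t * (M * (1 - a'))"
        using ac st by (intro add_mono mult_left_mono) auto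
      also have "\<dots> = M * ((s + t) - (s * a + t * a'))" by (simp add: algebra_simps)
      finally have "s * c + t * c' \<le> M * (1 - (s * a + t * a'))" using st by simp
      moreover have "s *\<^sub>R y + t *\<^sub>R z = (s * a + t * a') *\<^sub>R x + (s * c + t * c') *\<^sub>R w"
        by (simp add: ac algebra_simps)
      ultimately show "s *\<^sub>R y + t *\<^sub>R z \<in> Q" unfolding Q_def by blast
    qed
    moreover have "V \<subseteq> Q" unfolding Q_def using b slope by blast
    ultimately have PQ: "{y \<in> S. N y \<le> 1} \<subseteq> Q" unfolding V(2) by (rule hull_minimal[rotated])
    have "1 / M \<le> (N (x + s *\<^sub>R w) - N x) / s" if s: "0 < s" for s
    proof -
      define r where "r = N (x + s *\<^sub>R w)"
      have "1 \<le> r" using gN[of "x + s *\<^sub>R w"] gx w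
        by (simp add: r_def blinfun.add_right blinfun.scaleR_right)
      then have r: "0 < r" by simp
      have "(1 / r) *\<^sub>R (x + s *\<^sub>R w) \<in> {y \<in> S. N y \<le> 1}"
        using S r equivalent_norm_scale[OF N, of "1/r" "x + s *\<^sub>R w"]
        by (auto simp: r_def intro!: subspace_scale subspace_add)
      then obtain a c where ac: "(1 / r) *\<^sub>R (x + s *\<^sub>R w) = a *\<^sub>R x + c *\<^sub>R w" "c \<le> M * (1 - a)"
        using PQ unfolding Q_def by blast
      have "blinfun_apply g ((1 / r) *\<^sub>R (x + s *\<^sub>R w)) = blinfun_apply g (a *\<^sub>R x + c *\<^sub>R w)"
        by (simp only: ac(1))
      then have a: "a = 1 / r" using gx w by (simp add: blinfun.add_right blinfun.scaleR_right)
      have "(s / r) *\<^sub>R w = c *\<^sub>R w" using ac(1) a by (simp add: algebra_simps)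
      then have "c = s / r" using \<open>w \<noteq> 0\<close> by simp
      then have "s / r \<le> M * (1 - 1 / r)" using ac(2) a by simp
      then have "s \<le> M * (r - 1)" using r by (simp add: field_simps)
      then show ?thesis using M s x by (simp add: r_def field_simps)
    qed
    then have "1 / M \<le> dir_deriv N x w" by (rule dir_deriv_greatest)
    then have "1 / M \<le> 0" using w(2) by linarith
    then show ?thesis using M by (simp add: divide_le_0_iff)
  qed
qed

text \<open>Subtracting a multiple of \<open>x\<close> from \<open>v\<close> yields a tangential direction \<open>w\<close>, in which \<open>N\<close> does not
  grow for a while; scaling back from \<open>w\<close> to \<open>v\<close> uses that \<open>N\<close> and \<open>g\<close> are both positively
  homogeneous.\<close>

lemma polytope_norm_affine_along_ray:
  assumes N: "equivalent_norm N" and K: "K_polyhedral N" and x: "N x = 1"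
    and g: "g \<in> norming_functionals N x" and v: "blinfun_apply g v = dir_deriv N x v"
  shows "\<exists>t>0. N (x + t *\<^sub>R v) \<le> blinfun_apply g (x + t *\<^sub>R v)"
proof -
  have sub: "sublinear N" by (rule equivalent_norm_sublinear[OF N])
  have gx: "blinfun_apply g x = 1" using g by (auto simp: norming_functionals_iff[OF N x])
  define d where "d = blinfun_apply g v"
  define w where "w = v + (- d) *\<^sub>R x"
  have gw: "blinfun_apply g w = 0"
    using gx by (simp add: w_def d_def blinfun.add_right blinfun.diff_right blinfun.scaleR_right)
  have "dir_deriv N x ((- d) *\<^sub>R x) \<le> - d"
  proof -
    define t where "t = 1 / (\<bar>d\<bar> + 1)"
    have t: "0 < t" "t * d \<le> 1" by (auto simp: t_def divide_le_eq)
    have "x + t *\<^sub>R ((- d) *\<^sub>R x) = (1 - t * d) *\<^sub>R x" by (simp add: algebra_simps)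
    then have "N (x + t *\<^sub>R ((- d) *\<^sub>R x)) = 1 - t * d"
      using equivalent_norm_scale[OF N, of "1 - t * d" x] x t(2) by simp
    then show ?thesis using dir_deriv_le[OF sub t(1), of x "(- d) *\<^sub>R x"] x t(1) by simp
  qed
  then have dw: "dir_deriv N x w \<le> 0"
    using sublinear_add[OF dir_deriv_sublinear[OF sub], of x v "(- d) *\<^sub>R x"] v
    by (simp add: w_def d_def)
  obtain s0 where s0: "0 < s0" "N (x + s0 *\<^sub>R w) \<le> 1"
    using polytope_flat_direction[OF N K x g gw dw] by blast
  \<comment> \<open>shortening the step keeps \<open>1 - s * d\<close> positive\<close>
  define s where "s = min s0 (1 / (2 * (\<bar>d\<bar> + 1)))"
  have s: "0 < s" "s \<le> s0" using s0 by (auto simp: s_def)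
  have "s * d \<le> s * \<bar>d\<bar>" using s by (intro mult_left_mono) auto
  also have "\<dots> \<le> (1 / (2 * (\<bar>d\<bar> + 1))) * \<bar>d\<bar>" by (intro mult_right_mono) (auto simp: s_def)
  also have "\<dots> < 1" by (simp add: divide_less_eq)
  finally have sd: "0 < 1 - s * d" by simp
  have "x + s *\<^sub>R w = (1 - s/s0) *\<^sub>R x + (s/s0) *\<^sub>R (x + s0 *\<^sub>R w)"
    using s0 by (simp add: algebra_simps)
  then have "N (x + s *\<^sub>R w) \<le> N ((1 - s/s0) *\<^sub>R x) + N ((s/s0) *\<^sub>R (x + s0 *\<^sub>R w))"
    by (metis equivalent_norm_triangle[OF N])
  also have "\<dots> = (1 - s/s0) + (s/s0) * N (x + s0 *\<^sub>R w)"
    using s s0 x by (simp add: equivalent_norm_scale[OF N])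
  also have "\<dots> \<le> (1 - s/s0) + (s/s0) * 1"
    using s s0 by (intro add_mono mult_left_mono) auto
  finally have Ns: "N (x + s *\<^sub>R w) \<le> 1" by simp
  \<comment> \<open>\<open>t\<close> is chosen so that \<open>x + t *\<^sub>R v\<close> is a positive multiple of \<open>x + s *\<^sub>R w\<close>\<close>
  define t where "t = s / (1 - s * d)"
  have td: "1 + t * d = 1 / (1 - s * d)" using sd by (simp add: t_def field_simps)
  have "x + t *\<^sub>R v = (1 + t * d) *\<^sub>R x + t *\<^sub>R w"
    by (simp add: w_def algebra_simps)
  also have "\<dots> = (1 / (1 - s * d)) *\<^sub>R (x + s *\<^sub>R w)"
    unfolding td by (simp add: t_def scaleR_add_right)
  finally have eq: "x + t *\<^sub>R v = (1 / (1 - s * d)) *\<^sub>R (x + s *\<^sub>R w)" .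
  have "N (x + t *\<^sub>R v) \<le> 1 / (1 - s * d)"
    unfolding eq equivalent_norm_scale[OF N] using Ns sd by (simp add: divide_le_cancel)
  moreover have "blinfun_apply g (x + t *\<^sub>R v) = 1 / (1 - s * d)"
    unfolding eq using gx gw by (simp add: blinfun.add_right blinfun.scaleR_right)
  moreover have "0 < t" using s sd by (simp add: t_def)
  ultimately show ?thesis by (intro exI[of _ t]) simp
qed

text \<open>Let \<open>g\<close> be an extreme norming functional.  In each direction in which \<open>g\<close> is the largest of the
  extreme norming functionals, \<open>N\<close> agrees with \<open>g\<close> on a segment starting at \<open>x\<close>.  These directions form
  a polyhedral cone, and the displacements \<open>v\<close> with \<open>N (x + v) \<le> g (x + v)\<close> form a closed convex set, so the segments
  have a common positive length.  The finitely many cones cover the space.\<close>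

lemma K_polyhedral_Delta_imp_locally_polyhedral:
  fixes N :: "'a::banach \<Rightarrow> real"
  assumes N: "equivalent_norm N" and K: "K_polyhedral N" and Delta: "property_Delta N"
  shows "locally_polyhedral N"
  unfolding locally_polyhedral_def
proof (intro allI impI)
  fix x assume x: "N x = 1"
  have sub: "sublinear N" by (rule equivalent_norm_sublinear[OF N])
  define E where "E = {f. f extreme_point_of norming_functionals N x}"
  have E: "finite E" using Delta x by (simp add: property_Delta_def E_def)
  have EN: "g \<in> norming_functionals N x" if "g \<in> E" for g
    using that by (simp add: E_def extreme_point_of_def)
  have Ele: "blinfun_apply g y \<le> N y" "blinfun_apply g x = 1" if "g \<in> E" for g y
    using EN[OF that] by (auto simp: norming_functionals_iff[OF N x])
  have att: "\<exists>g\<in>E. blinfun_apply g v = dir_deriv N x v" for v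
    using extreme_functional_attains_dir_deriv[OF N x, of v] unfolding E_def by blast
  have Edir: "blinfun_apply g v \<le> dir_deriv N x v" if "g \<in> E" for g v
    using linear_le_dir_deriv_iff[OF sub linear_blinfun_apply, of g x] Ele[OF that] x by simp
  have "\<exists>\<epsilon>>0. \<forall>v. blinfun_apply g v = dir_deriv N x v \<longrightarrow> norm v < \<epsilon> \<longrightarrow> N (x + v) \<le> blinfun_apply g (x + v)"
    if g: "g \<in> E" for g
  proof -
    define A where "A = (\<lambda>y. y - x) ` support_cone N g"
    have A: "v \<in> A \<longleftrightarrow> N (x + v) \<le> blinfun_apply g (x + v)" for v
      by (force simp: A_def support_cone_def image_iff algebra_simps)
    have "closed A" "convex A"
      unfolding A_def
      using closed_translation_subtract[OF closed_support_cone[OF N]]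
        convex_translation_subtract[OF convex_support_cone[OF N]] by auto
    moreover have "\<exists>t>0. t *\<^sub>R v \<in> A"
      if "\<And>h. h \<in> (\<lambda>k. g - k) ` E \<Longrightarrow> 0 \<le> blinfun_apply h v" for v
    proof -
      obtain k where k: "k \<in> E" "blinfun_apply k v = dir_deriv N x v" using att by blast
      have "blinfun_apply k v \<le> blinfun_apply g v"
        using that[of "g - k"] k(1) by (simp add: blinfun.diff_left)
      then have "blinfun_apply g v = dir_deriv N x v" using k(2) Edir[OF g, of v] by simp
      then show ?thesis using polytope_norm_affine_along_ray[OF N K x EN[OF g]] by (simp add: A)
    qed
    ultimately obtain \<epsilon> where \<epsilon>: "0 < \<epsilon>"
      "\<And>v. (\<forall>h\<in>(\<lambda>k. g - k) ` E. 0 \<le> blinfun_apply h v) \<Longrightarrow> norm v < \<epsilon> \<Longrightarrow> v \<in> A"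
      using absorbing_polyhedral_cone[of A UNIV "(\<lambda>k. g - k) ` E"] E by auto
    have "v \<in> A" if "blinfun_apply g v = dir_deriv N x v" "norm v < \<epsilon>" for v
      using \<epsilon>(2)[OF _ that(2)] that(1) Edir by (auto simp: blinfun.diff_left)
    then show ?thesis using \<epsilon>(1) by (auto simp: A)
  qed
  then obtain \<epsilon> where \<epsilon>: "\<And>g. g \<in> E \<Longrightarrow> 0 < \<epsilon> g"
    "\<And>g v. g \<in> E \<Longrightarrow> blinfun_apply g v = dir_deriv N x v \<Longrightarrow> norm v < \<epsilon> g \<Longrightarrow> N (x + v) \<le> blinfun_apply g (x + v)"
    by metis
  define r where "r = Min (\<epsilon> ` E)"
  have "E \<noteq> {}" using att by blast
  then have "r \<in> \<epsilon> ` E" unfolding r_def using E by (intro Min_in) auto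
  then have r: "0 < r" "\<And>g. g \<in> E \<Longrightarrow> r \<le> \<epsilon> g" using E \<epsilon>(1) by (auto simp: r_def)
  have "\<exists>g\<in>E. N y = blinfun_apply g y" if "dist y x < r" for y
  proof -
    obtain g where g: "g \<in> E" "blinfun_apply g (y - x) = dir_deriv N x (y - x)" using att by blast
    have "norm (y - x) < \<epsilon> g" using that r(2)[OF g(1)] by (simp add: dist_norm)
    then have "N (x + (y - x)) \<le> blinfun_apply g (x + (y - x))" by (rule \<epsilon>(2)[OF g])
    then show ?thesis using g(1) Ele(1)[OF g(1), of y] by (intro bexI[of _ g]) auto
  qed
  then have "\<forall>\<^sub>F y in nhds x. \<exists>g\<in>E. N y = blinfun_apply g y"
    unfolding eventually_nhds_metric using r(1) by blast
  then show "\<exists>G :: ('a \<Rightarrow>\<^sub>L real) set. finite G \<and> (\<forall>g\<in>G. \<forall>y. blinfun_apply g y \<le> N y) \<and>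
      (\<forall>\<^sub>F y in nhds x. \<exists>g\<in>G. N y = blinfun_apply g y)"
    using E Ele(1) by (intro exI[of _ E]) auto
qed

section \<open>The conical tiling of a locally polyhedral norm\<close>

text \<open>The finite case of Baire's theorem, which holds in every topological space.\<close>

lemma finite_closed_cover_interior:
  assumes "finite I" "\<And>i. i \<in> I \<Longrightarrow> closed (C i)" "open V" "V \<noteq> {}" "V \<subseteq> (\<Union>i\<in>I. C i)"
  shows "\<exists>i\<in>I. V \<inter> interior (C i) \<noteq> {}"
  using assms
proof (induction I arbitrary: V rule: finite_induct)
  case empty
  then show ?case by simp
next
  case (insert k I)
  show ?case
  proof (cases "V \<subseteq> C k")
    case True
    then have "V \<subseteq> interior (C k)" using insert.prems by (simp add: interior_maximal)
    then show ?thesis using insert.prems by blast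
  next
    case False
    have "\<exists>i\<in>I. (V - C k) \<inter> interior (C i) \<noteq> {}"
      using insert.prems False by (intro insert.IH) (auto intro!: open_Diff)
    then show ?thesis by blast
  qed
qed

lemma blinfun_eq_on_open:
  fixes f g :: "'a::real_normed_vector \<Rightarrow>\<^sub>L real"
  assumes V: "open V" "z \<in> V" and eq: "\<And>y. y \<in> V \<Longrightarrow> blinfun_apply f y = blinfun_apply g y"
  shows "f = g"
proof (rule blinfun_eqI)
  fix v
  have "\<forall>\<^sub>F y in nhds z. y \<in> V" using V by (rule eventually_nhds_in_open)
  then obtain t where "0 < t" "z + t *\<^sub>R v \<in> V" by (rule eventually_nhds_along_ray)
  then show "blinfun_apply f v = blinfun_apply g v"
    using eq[of "z + t *\<^sub>R v"] eq[OF V(2)] by (simp add: blinfun.add_right blinfun.scaleR_right)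
qed

lemma blinfun_not_constant_on_open:
  fixes f :: "'a::real_normed_vector \<Rightarrow>\<^sub>L real"
  assumes V: "open V" "z \<in> V" and const: "\<And>y. y \<in> V \<Longrightarrow> blinfun_apply f y = k" and "k \<noteq> 0"
  shows False
proof -
  have "\<forall>\<^sub>F y in nhds z. y \<in> V" using V by (rule eventually_nhds_in_open)
  then obtain t where "0 < t" "z + t *\<^sub>R z \<in> V" by (rule eventually_nhds_along_ray)
  then show False
    using const[of "z + t *\<^sub>R z"] const[OF V(2)] \<open>k \<noteq> 0\<close> by (simp add: blinfun.add_right blinfun.scaleR_right)
qed

text \<open>The condition \<open>c \<noteq> 0\<close> matters in the trivial space only: there the zero functional has a support cone
  with interior, but no part of this cone reaches norm \<open>1\<close>.\<close>

definition facets :: "('a::real_normed_vector \<Rightarrow> real) \<Rightarrow> ('a \<Rightarrow>\<^sub>L real) set" where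
  "facets N = {f. (\<forall>y. blinfun_apply f y \<le> N y) \<and> (\<exists>c\<in>interior (support_cone N f). c \<noteq> 0)}"

text \<open>Near \<open>x\<close> finitely many support cones cover, and those without interior can be left out by the
  finite Baire argument.  Conversely the cone of any facet that comes near \<open>x\<close> has interior points there,
  as a convex set with interior points has some near each of its points; by the same argument one of
  the finitely many functionals agrees with this facet on an open set, and so equals it.\<close>

lemma finitely_many_facets_near:
  assumes N: "equivalent_norm N" and lp: "locally_polyhedral N" and x: "N x = 1"
  obtains U G where "open U" "x \<in> U" "finite G" "G \<subseteq> facets N"
    "\<And>y. y \<in> U \<Longrightarrow> \<exists>f\<in>G. y \<in> support_cone N f"
    "\<And>f. f \<in> facets N \<Longrightarrow> support_cone N f \<inter> U \<noteq> {} \<Longrightarrow> f \<in> G"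
proof -
  obtain G :: "('a \<Rightarrow>\<^sub>L real) set" where G: "finite G" and le: "\<forall>g\<in>G. \<forall>y. blinfun_apply g y \<le> N y"
    and ev: "\<forall>\<^sub>F y in nhds x. \<exists>g\<in>G. N y = blinfun_apply g y"
    using lp x unfolding locally_polyhedral_def by blast
  obtain W where W: "open W" "x \<in> W" "\<forall>y\<in>W. \<exists>g\<in>G. N y = blinfun_apply g y"
    using ev unfolding eventually_nhds by (elim exE conjE)
  \<comment> \<open>without the origin, interior points of support cones found in \<open>U\<close> are the nonzero ones that \<open>facets\<close> asks for\<close>
  define U where "U = W - {0}"
  have "x \<noteq> 0" using x equivalent_norm_eq_0_iff[OF N, of 0] by auto
  then have U: "open U" "x \<in> U" using W by (auto simp: U_def intro: open_Diff)
  have UG: "\<exists>g\<in>G. y \<in> support_cone N g" if "y \<in> U" for y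
    using that W(3) by (force simp: U_def support_cone_def)
  show thesis
  proof (rule that[OF U, of "G \<inter> facets N"])
    fix f assume f: "f \<in> facets N" "support_cone N f \<inter> U \<noteq> {}"
    obtain c where c: "c \<in> interior (support_cone N f)" using f(1) by (auto simp: facets_def)
    obtain y where y: "y \<in> support_cone N f" "y \<in> U" using f(2) by blast
    have "\<forall>\<^sub>F y in nhds y. y \<in> U" using U(1) y(2) by (rule eventually_nhds_in_open)
    then obtain s where s: "0 < s" "s < 1" "y + s *\<^sub>R (c - y) \<in> U" by (rule eventually_nhds_along_ray)
    define V where "V = U \<inter> interior (support_cone N f)"
    have "y + s *\<^sub>R (c - y) \<in> V"
      using s convex_interior_shrink[OF convex_support_cone[OF N] c y(1), of s] by (simp add: V_def)
    moreover have "open V" using U(1) by (auto simp: V_def)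
    moreover have "V \<subseteq> (\<Union>g\<in>G. support_cone N g)" using UG by (auto simp: V_def)
    ultimately obtain g where g: "g \<in> G" "V \<inter> interior (support_cone N g) \<noteq> {}"
      using finite_closed_cover_interior[OF G, of "support_cone N" V] closed_support_cone[OF N] by blast
    then obtain z where z: "z \<in> V \<inter> interior (support_cone N g)" by blast
    have "f = g"
    proof (rule blinfun_eq_on_open[OF _ z])
      show "open (V \<inter> interior (support_cone N g))" using \<open>open V\<close> by auto
      fix y assume "y \<in> V \<inter> interior (support_cone N g)"
      then have "y \<in> support_cone N f" "y \<in> support_cone N g"
        using interior_subset by (auto simp: V_def)
      then have "N y \<le> blinfun_apply f y" "N y \<le> blinfun_apply g y" by (simp_all add: support_cone_def)
      moreover have "blinfun_apply f y \<le> N y" using f(1) by (simp add: facets_def)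
      moreover have "blinfun_apply g y \<le> N y" using g(1) le by blast
      ultimately show "blinfun_apply f y = blinfun_apply g y" by linarith
    qed
    then show "f \<in> G \<inter> facets N" using f(1) g(1) by simp
  next
    fix y assume y: "y \<in> U"
    show "\<exists>f\<in>G \<inter> facets N. y \<in> support_cone N f"
    proof (rule ccontr)
      assume no: "\<not> (\<exists>f\<in>G \<inter> facets N. y \<in> support_cone N f)"
      define V where "V = U - (\<Union>f\<in>G \<inter> facets N. support_cone N f)"
      have "open V"
        unfolding V_def using G U(1) closed_support_cone[OF N] by (intro open_Diff closed_UN) auto
      moreover have "y \<in> V" using y no by (auto simp: V_def)
      moreover have "V \<subseteq> (\<Union>g\<in>G - facets N. support_cone N g)"
        using UG unfolding V_def by blast
      ultimately obtain g where g: "g \<in> G - facets N" "V \<inter> interior (support_cone N g) \<noteq> {}"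
        using finite_closed_cover_interior[of "G - facets N" "support_cone N" V] G closed_support_cone[OF N]
        by blast
      then obtain z where "z \<in> V" "z \<in> interior (support_cone N g)" by blast
      moreover have "z \<noteq> 0" using \<open>z \<in> V\<close> by (simp add: V_def U_def)
      ultimately have "g \<in> facets N" using g(1) le by (auto simp: facets_def)
      then show False using g(1) by simp
    qed
  qed (use G in auto)
qed

definition cone_slice :: "('a::real_normed_vector \<Rightarrow> real) \<Rightarrow> ('a \<Rightarrow>\<^sub>L real) \<Rightarrow> nat \<Rightarrow> 'a set" where
  "cone_slice N f n = {x \<in> support_cone N f. real n \<le> blinfun_apply f x \<and> blinfun_apply f x \<le> real n + 1}"

lemma equivalent_norm_sublevel_bounded:
  assumes N: "equivalent_norm N"
  shows "bounded {x. N x \<le> r}"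
proof -
  obtain c where c: "0 < c" "\<And>x. c * norm x \<le> N x"
    using N unfolding equivalent_norm_def by blast
  have "norm x \<le> r / c" if "N x \<le> r" for x
    using order_trans[OF c(2) that] c(1) by (simp add: pos_le_divide_eq mult.commute)
  then show ?thesis by (auto simp: bounded_iff)
qed

lemma convex_body_unit_ball:
  assumes N: "equivalent_norm N"
  shows "convex_body {x. N x \<le> 1}"
  unfolding convex_body_def
proof (intro conjI)
  show "closed {x. N x \<le> 1}"
    by (intro closed_Collect_le equivalent_norm_continuous[OF N] continuous_on_const)
  show "convex {x. N x \<le> 1}"
  proof (rule convexI)
    fix u v and s t :: real
    assume uv: "u \<in> {x. N x \<le> 1}" "v \<in> {x. N x \<le> 1}" and st: "0 \<le> s" "0 \<le> t" "s + t = 1"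
    have "N (s *\<^sub>R u + t *\<^sub>R v) \<le> s * N u + t * N v"
      using equivalent_norm_triangle[OF N, of "s *\<^sub>R u" "t *\<^sub>R v"] st
      by (simp add: equivalent_norm_scale[OF N])
    also have "\<dots> \<le> 1" using uv st by (intro convex_bound_le) auto
    finally show "s *\<^sub>R u + t *\<^sub>R v \<in> {x. N x \<le> 1}" by simp
  qed
  have "open {x. N x < 1}"
    by (intro open_Collect_less equivalent_norm_continuous[OF N] continuous_on_const)
  then have "{x. N x < 1} \<subseteq> interior {x. N x \<le> 1}" by (rule interior_maximal[rotated]) auto
  moreover have "N 0 < 1" using equivalent_norm_eq_0_iff[OF N, of 0] by simp
  ultimately show "interior {x. N x \<le> 1} \<noteq> {}" by blast
qed

lemma convex_body_cone_slice:
  assumes N: "equivalent_norm N" and f: "f \<in> facets N"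
  shows "convex_body (cone_slice N f n)"
  unfolding convex_body_def
proof (intro conjI)
  have eq: "cone_slice N f n = support_cone N f \<inter> {x. real n \<le> blinfun_apply f x} \<inter> {x. blinfun_apply f x \<le> real n + 1}"
    by (auto simp: cone_slice_def)
  show "closed (cone_slice N f n)"
    unfolding eq by (intro closed_Int closed_support_cone[OF N] closed_Collect_le blinfun_continuous continuous_on_const)
  have "convex {x. real n \<le> blinfun_apply f x}" "convex {x. blinfun_apply f x \<le> real n + 1}"
    using convex_linear_vimage[OF linear_blinfun_apply, of "{real n..}" f]
      convex_linear_vimage[OF linear_blinfun_apply, of "{..real n + 1}" f]
    by (simp_all add: vimage_def)
  then show "convex (cone_slice N f n)"
    unfolding eq by (intro convex_Int convex_support_cone[OF N])
  obtain c where c: "c \<in> interior (support_cone N f)" "c \<noteq> 0" using f by (auto simp: facets_def)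
  have "0 < N c" using equivalent_norm_pos[OF N c(2)] .
  also have "N c \<le> blinfun_apply f c" using c(1) interior_subset by (auto simp: support_cone_def)
  finally have fc: "0 < blinfun_apply f c" .
  \<comment> \<open>scaling \<open>c\<close> by \<open>s\<close> puts it at half height in the slice\<close>
  define s where "s = (real n + 1/2) / blinfun_apply f c"
  have s: "0 < s" using fc by (simp add: s_def)
  define V where "V = ((\<lambda>y. (1/s) *\<^sub>R y) -` interior (support_cone N f))
    \<inter> {y. real n < blinfun_apply f y} \<inter> {y. blinfun_apply f y < real n + 1}"
  have "open V"
    unfolding V_def
    by (intro open_Int open_vimage open_interior open_Collect_less blinfun_continuous continuous_on_const
        continuous_on_scaleR continuous_on_id)
  moreover have "V \<subseteq> cone_slice N f n"
  proof
    fix y assume y: "y \<in> V"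
    then have "(1/s) *\<^sub>R y \<in> support_cone N f" using interior_subset by (auto simp: V_def)
    then have "y \<in> support_cone N f" using support_cone_scale[OF N, of "1/s" y f] s by simp
    then show "y \<in> cone_slice N f n" using y by (simp add: V_def cone_slice_def)
  qed
  moreover have "s *\<^sub>R c \<in> V"
    using c fc s by (simp add: V_def blinfun.scaleR_right) (simp add: s_def)
  ultimately show "interior (cone_slice N f n) \<noteq> {}" using interior_maximal by blast
qed

lemma cone_slice_norm:
  assumes "f \<in> facets N" "x \<in> cone_slice N f n"
  shows "N x = blinfun_apply f x" "real n \<le> N x" "N x \<le> real n + 1"
proof -
  show "N x = blinfun_apply f x"
    using assms by (intro order_antisym) (auto simp: cone_slice_def support_cone_def facets_def)
  then show "real n \<le> N x" "N x \<le> real n + 1" using assms(2) by (auto simp: cone_slice_def)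
qed

definition conical_tiling :: "('a::real_normed_vector \<Rightarrow> real) \<Rightarrow> 'a set set" where
  "conical_tiling N = insert {x. N x \<le> 1} {cone_slice N f n | f n. f \<in> facets N \<and> 1 \<le> n}"

text \<open>On a common open set the two functionals both equal \<open>N\<close>, hence coincide, so the slices differ in
  height and share at most a level set of a functional, which has empty interior.\<close>

lemma disjnt_interior_slices:
  assumes f: "f \<in> facets N" "1 \<le> n" and g: "g \<in> facets N" "1 \<le> m"
    and ne: "cone_slice N f n \<noteq> cone_slice N g m"
  shows "disjnt (interior (cone_slice N f n)) (interior (cone_slice N g m))"
proof (rule ccontr)
  assume meet: "\<not> ?thesis"
  define V where "V = interior (cone_slice N f n) \<inter> interior (cone_slice N g m)"
  obtain z where z: "z \<in> V" using meet by (auto simp: disjnt_def V_def)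
  have V: "open V" "V \<subseteq> cone_slice N f n" "V \<subseteq> cone_slice N g m"
    using interior_subset unfolding V_def by (auto intro: open_Int)
  have eq: "blinfun_apply f y = N y" "blinfun_apply g y = N y" "real n \<le> N y" "N y \<le> real n + 1"
    "real m \<le> N y" "N y \<le> real m + 1" if "y \<in> V" for y
    using that V cone_slice_norm[OF f(1), of y n] cone_slice_norm[OF g(1), of y m] by auto
  have "f = g" using blinfun_eq_on_open[OF V(1) z, of f g] eq by simp
  then have "n < m \<or> m < n" using ne by auto
  then show False
  proof
    assume "n < m"
    then have "blinfun_apply f y = real m" if "y \<in> V" for y using eq[OF that] by simp
    then show False using blinfun_not_constant_on_open[OF V(1) z, of f "real m"] g by simp
  next
    assume "m < n"
    then have "blinfun_apply f y = real n" if "y \<in> V" for y using eq[OF that] by simp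
    then show False using blinfun_not_constant_on_open[OF V(1) z, of f "real n"] f by simp
  qed
qed

lemma disjnt_interior_ball_slice:
  assumes f: "f \<in> facets N" "1 \<le> n"
  shows "disjnt (interior {x. N x \<le> 1}) (interior (cone_slice N f n))"
proof (rule ccontr)
  assume meet: "\<not> ?thesis"
  define V where "V = interior {x. N x \<le> 1} \<inter> interior (cone_slice N f n)"
  obtain z where z: "z \<in> V" using meet by (auto simp: disjnt_def V_def)
  have V: "open V" "V \<subseteq> {x. N x \<le> 1}" "V \<subseteq> cone_slice N f n"
    using interior_subset unfolding V_def by (auto intro: open_Int)
  have "blinfun_apply f y = 1" if "y \<in> V" for y
    using that V cone_slice_norm[OF f(1), of y n] f(2) by force
  then show False using blinfun_not_constant_on_open[OF V(1) z, of f 1] by simp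
qed

text \<open>A point \<open>x\<close> with \<open>N x < 1\<close> has a neighbourhood that meets only the unit ball, since the slices
  start at height \<open>1\<close>.  Any other \<open>x\<close> is a positive multiple of a point of the unit sphere, near which there are
  only finitely many facets, and \<open>N\<close> bounds the heights of the slices that come near \<open>x\<close>.\<close>

lemma locally_polyhedral_imp_tiling:
  assumes N: "equivalent_norm N" and lp: "locally_polyhedral N"
  shows "tiling (conical_tiling N)" "\<forall>C\<in>conical_tiling N. bounded C"
    "locally_finite_in euclidean (conical_tiling N)"
proof -
  show "tiling (conical_tiling N)"
    unfolding tiling_def
  proof (intro conjI)
    show "\<forall>C\<in>conical_tiling N. convex_body C"
      using convex_body_unit_ball[OF N] convex_body_cone_slice[OF N] by (auto simp: conical_tiling_def)
    show "\<Union>(conical_tiling N) = UNIV"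
    proof (intro equalityI subset_UNIV subsetI)
      fix x
      show "x \<in> \<Union>(conical_tiling N)"
      proof (cases "N x \<le> 1")
        case True then show ?thesis by (auto simp: conical_tiling_def)
      next
        case False
        then have pos: "0 < N x" by simp
        have "N ((1 / N x) *\<^sub>R x) = 1" using pos by (simp add: equivalent_norm_scale[OF N])
        then obtain f where f: "f \<in> facets N" "(1 / N x) *\<^sub>R x \<in> support_cone N f"
          using finitely_many_facets_near[OF N lp] by (metis subsetD)
        have x: "x \<in> support_cone N f" using f(2) support_cone_scale[OF N, of "1 / N x" x f] pos by simp
        define n where "n = nat \<lfloor>N x\<rfloor>"
        have "1 \<le> n" using False by (simp add: n_def le_nat_iff le_floor_iff)
        have "N x = blinfun_apply f x"
          using x f(1) by (intro order_antisym) (auto simp: support_cone_def facets_def)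
        moreover have "real n \<le> N x" "N x \<le> real n + 1"
          using pos by (auto simp: n_def)
        ultimately have "x \<in> cone_slice N f n" using x by (simp add: cone_slice_def)
        then show ?thesis using f(1) \<open>1 \<le> n\<close> by (auto simp: conical_tiling_def)
      qed
    qed
    show "pairwise (\<lambda>A B. disjnt (interior A) (interior B)) (conical_tiling N)"
    proof (rule pairwiseI)
      fix A B assume AB: "A \<in> conical_tiling N" "B \<in> conical_tiling N" "A \<noteq> B"
      have slice: "A = {x. N x \<le> 1} \<or> (\<exists>f n. f \<in> facets N \<and> 1 \<le> n \<and> A = cone_slice N f n)"
        if "A \<in> conical_tiling N" for A
        using that unfolding conical_tiling_def by blast
      show "disjnt (interior A) (interior B)"
        using slice[OF AB(1)] slice[OF AB(2)] AB(3)
        by (elim disjE exE conjE) (metis disjnt_sym disjnt_interior_ball_slice disjnt_interior_slices)+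
    qed
  qed
  show "\<forall>C\<in>conical_tiling N. bounded C"
  proof
    fix C assume "C \<in> conical_tiling N"
    then consider "C = {x. N x \<le> 1}" | f n where "f \<in> facets N" "C = cone_slice N f n"
      by (auto simp: conical_tiling_def)
    then show "bounded C"
    proof cases
      case 1 then show ?thesis using equivalent_norm_sublevel_bounded[OF N] by simp
    next
      case 2
      then have "C \<subseteq> {x. N x \<le> real n + 1}" using cone_slice_norm(3) by blast
      then show ?thesis using equivalent_norm_sublevel_bounded[OF N] bounded_subset by blast
    qed
  qed
  have "\<exists>V. open V \<and> x \<in> V \<and> finite {C \<in> conical_tiling N. C \<inter> V \<noteq> {}}" for x
  proof (cases "N x < 1")
    case True
    define V where "V = {y. N y < 1}"
    have "open V" unfolding V_def
      by (intro open_Collect_less equivalent_norm_continuous[OF N] continuous_on_const)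
    moreover have "{C \<in> conical_tiling N. C \<inter> V \<noteq> {}} \<subseteq> {{x. N x \<le> 1}}"
    proof
      fix C assume C: "C \<in> {C \<in> conical_tiling N. C \<inter> V \<noteq> {}}"
      have False if fn: "f \<in> facets N" "1 \<le> n" "C = cone_slice N f n" for f n
      proof -
        obtain y where "y \<in> cone_slice N f n" "N y < 1" using C fn(3) by (auto simp: V_def)
        then show False using cone_slice_norm(2)[OF fn(1)] fn(2) by force
      qed
      then show "C \<in> {{x. N x \<le> 1}}" using C by (auto simp: conical_tiling_def)
    qed
    ultimately show ?thesis
      using True finite_subset by (intro exI[of _ V]) (auto simp: V_def)
  next
    case False
    then have pos: "0 < N x" by simp
    have "N ((1 / N x) *\<^sub>R x) = 1" using pos by (simp add: equivalent_norm_scale[OF N])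
    then obtain U G where U: "open U" "(1 / N x) *\<^sub>R x \<in> U" "finite G"
      "\<And>f. f \<in> facets N \<Longrightarrow> support_cone N f \<inter> U \<noteq> {} \<Longrightarrow> f \<in> G"
      using finitely_many_facets_near[OF N lp] by metis
    define V where "V = (\<lambda>y. (1 / N x) *\<^sub>R y) -` U \<inter> {y. N y < N x + 1}"
    have "open V" unfolding V_def
      by (intro open_Int open_vimage U(1) open_Collect_less equivalent_norm_continuous[OF N]
          continuous_on_const continuous_on_scaleR continuous_on_id)
    have "{C \<in> conical_tiling N. C \<inter> V \<noteq> {}}
      \<subseteq> insert {x. N x \<le> 1} ((\<lambda>(f, n). cone_slice N f n) ` (G \<times> {n. real n \<le> N x + 1}))"
    proof
      fix C assume C: "C \<in> {C \<in> conical_tiling N. C \<inter> V \<noteq> {}}"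
      have "f \<in> G \<and> real n \<le> N x + 1" if fn: "f \<in> facets N" "C = cone_slice N f n" for f n
      proof -
        obtain y where y: "y \<in> cone_slice N f n" "y \<in> V" using C fn(2) by auto
        have "(1 / N x) *\<^sub>R y \<in> support_cone N f"
          using y(1) support_cone_scale[OF N, of "1 / N x" y f] pos by (simp add: cone_slice_def)
        then have "f \<in> G" using y(2) by (intro U(4)[OF fn(1)]) (auto simp: V_def)
        moreover have "real n \<le> N y" using cone_slice_norm(2)[OF fn(1) y(1)] .
        ultimately show ?thesis using y(2) by (simp add: V_def)
      qed
      then show "C \<in> insert {x. N x \<le> 1} ((\<lambda>(f, n). cone_slice N f n) ` (G \<times> {n. real n \<le> N x + 1}))"
        using C by (auto simp: conical_tiling_def)
    qed
    moreover have "finite {n. real n \<le> N x + 1}"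
      by (rule finite_subset[of _ "{..nat \<lceil>N x + 1\<rceil>}"]) (auto, linarith)
    ultimately have "finite {C \<in> conical_tiling N. C \<inter> V \<noteq> {}}"
      using U(3) by (elim finite_subset) simp
    moreover have "x \<in> V" using U(2) by (simp add: V_def)
    ultimately show ?thesis using \<open>open V\<close> by blast
  qed
  then show "locally_finite_in euclidean (conical_tiling N)"
    unfolding locally_finite_in_def by simp
qed

section \<open>The norm given by a tile\<close>

text \<open>The Minkowski functional of \<open>W\<close>.\<close>

definition gauge_of :: "'a::real_vector set \<Rightarrow> 'a \<Rightarrow> real" where
  "gauge_of W x = Inf {t. 0 < t \<and> (1/t) *\<^sub>R x \<in> W}"

locale convex_nhd_of_0 =
  fixes W :: "'a::real_normed_vector set" and r :: real
  assumes conv: "convex W" and r: "0 < r" and ball: "ball 0 r \<subseteq> W"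
begin

lemma zero_mem: "0 \<in> W" using ball r by auto

lemma gauge_le: "0 < t \<Longrightarrow> (1/t) *\<^sub>R x \<in> W \<Longrightarrow> gauge_of W x \<le> t"
  unfolding gauge_of_def by (rule cInf_lower) (auto intro: bdd_belowI[of _ 0])

lemma mem_of_large: "norm x / r < t \<Longrightarrow> 0 < t \<and> (1/t) *\<^sub>R x \<in> W"
proof -
  assume t: "norm x / r < t"
  moreover have "0 \<le> norm x / r" using r by simp
  ultimately have "0 < t" by linarith
  moreover have "norm x < r * t" using t r by (simp add: pos_divide_less_eq mult.commute)
  ultimately have "(1/t) *\<^sub>R x \<in> ball 0 r" by (simp add: dist_norm divide_less_eq mult.commute)
  then show ?thesis using ball \<open>0 < t\<close> by blast
qed

lemma mem_of_gauge_less: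
  assumes "gauge_of W x < t"
  shows "0 < t" "(1/t) *\<^sub>R x \<in> W"
proof -
  have "{t. 0 < t \<and> (1/t) *\<^sub>R x \<in> W} \<noteq> {}"
    using mem_of_large[of x "norm x / r + 1"] by auto
  then obtain s where s: "0 < s" "(1/s) *\<^sub>R x \<in> W" "s < t"
    using assms unfolding gauge_of_def by (metis (mono_tags, lifting) cInf_lessD mem_Collect_eq)
  then show "0 < t" by simp
  have "(1/t) *\<^sub>R x = (s/t) *\<^sub>R ((1/s) *\<^sub>R x) + (1 - s/t) *\<^sub>R 0" using s by simp
  also have "\<dots> \<in> W" using s zero_mem by (intro convexD[OF conv]) auto
  finally show "(1/t) *\<^sub>R x \<in> W" .
qed

lemma gauge_nonneg: "0 \<le> gauge_of W x"
  using mem_of_gauge_less(1)[of x] by (meson not_le less_irrefl dense)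

lemma gauge_le_norm: "gauge_of W x \<le> norm x / r"
  using mem_of_large gauge_le by (meson dense_ge)

lemma gauge_sublinear: "sublinear (gauge_of W)"
  unfolding sublinear_def
proof (intro conjI allI impI)
  fix x y
  show "gauge_of W (x + y) \<le> gauge_of W x + gauge_of W y"
  proof (rule field_le_epsilon)
    fix e :: real assume "0 < e"
    define s t where "s = gauge_of W x + e/2" and "t = gauge_of W y + e/2"
    have lt: "gauge_of W x < s" "gauge_of W y < t" using \<open>0 < e\<close> by (auto simp: s_def t_def)
    have s: "0 < s" "(1/s) *\<^sub>R x \<in> W" and t: "0 < t" "(1/t) *\<^sub>R y \<in> W"
      using mem_of_gauge_less[OF lt(1)] mem_of_gauge_less[OF lt(2)] by auto
    have "s / (s + t) + t / (s + t) = 1" using s t by (simp flip: add_divide_distrib)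
    then have "(s / (s + t)) *\<^sub>R ((1/s) *\<^sub>R x) + (t / (s + t)) *\<^sub>R ((1/t) *\<^sub>R y) \<in> W"
      using s t by (intro convexD[OF conv]) auto
    also have "(s / (s + t)) *\<^sub>R ((1/s) *\<^sub>R x) + (t / (s + t)) *\<^sub>R ((1/t) *\<^sub>R y) = (1 / (s + t)) *\<^sub>R (x + y)"
      using s t by (simp add: scaleR_add_right)
    finally have "gauge_of W (x + y) \<le> s + t" using s t by (intro gauge_le) auto
    then show "gauge_of W (x + y) \<le> gauge_of W x + gauge_of W y + e" by (simp add: s_def t_def)
  qed
next
  have le: "gauge_of W (c *\<^sub>R x) \<le> c * gauge_of W x" if "0 < c" for c x
  proof -
    have "gauge_of W (c *\<^sub>R x) / c \<le> t" if "gauge_of W x < t" for t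
    proof -
      have "gauge_of W (c *\<^sub>R x) \<le> c * t"
        using mem_of_gauge_less[OF that] \<open>0 < c\<close> by (intro gauge_le) auto
      then show ?thesis using \<open>0 < c\<close> by (simp add: pos_divide_le_eq mult.commute)
    qed
    then have "gauge_of W (c *\<^sub>R x) / c \<le> gauge_of W x" by (rule dense_ge)
    then show ?thesis using that by (simp add: pos_divide_le_eq mult.commute)
  qed
  fix t :: real and x :: 'a assume t: "0 \<le> t"
  show "gauge_of W (t *\<^sub>R x) = t * gauge_of W x"
  proof (cases "t = 0")
    case True
    then show ?thesis using gauge_nonneg[of 0] gauge_le_norm[of 0] by simp
  next
    case False
    then have "0 < t" using t by simp
    then have "gauge_of W x \<le> (1/t) * gauge_of W (t *\<^sub>R x)"
      using le[of "1/t" "t *\<^sub>R x"] by simp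
    then show ?thesis
      using le[OF \<open>0 < t\<close>, of x] \<open>0 < t\<close> by (simp add: field_simps)
  qed
qed

lemma functional_le_gauge:
  assumes f: "linear f" and le: "\<And>y. y \<in> W \<Longrightarrow> f y \<le> 1"
  shows "f x \<le> gauge_of W x"
proof (rule dense_ge)
  fix t assume "gauge_of W x < t"
  then have t: "0 < t" "(1/t) *\<^sub>R x \<in> W" using mem_of_gauge_less by blast+
  then show "f x \<le> t" using le[OF t(2)] by (simp add: linear_scale[OF f] pos_divide_le_eq)
qed

end

text \<open>The Hahn--Banach separation theorem, normalised: since the origin is interior to \<open>A\<close>, the
  separating value is positive and can be scaled to \<open>1\<close>.  The set \<open>W\<close> in the proof is the difference
  of the interiors, translated by a point \<open>b\<close> such that the origin is interior to \<open>W\<close>;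
  disjointness of the interiors means that \<open>b\<close> lies outside \<open>W\<close>.\<close>

lemma separate_convex_bodies:
  fixes A B :: "'a::real_normed_vector set"
  assumes A: "convex A" "0 \<in> interior A" and B: "convex B" "interior B \<noteq> {}"
    and disj: "disjnt (interior A) (interior B)"
  obtains g :: "'a \<Rightarrow>\<^sub>L real" where "\<And>a. a \<in> A \<Longrightarrow> blinfun_apply g a \<le> 1"
    "\<And>y. y \<in> B \<Longrightarrow> 1 \<le> blinfun_apply g y"
proof -
  obtain b where b: "b \<in> interior B" using B(2) by blast
  obtain r where r: "0 < r" "ball 0 r \<subseteq> interior A"
    using A(2) open_contains_ball[of "interior A"] by auto
  define W where "W = {a - y + b | a y. a \<in> interior A \<and> y \<in> interior B}"
  have "convex W"
  proof (rule convexI)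
    fix u v and s t :: real assume uv: "u \<in> W" "v \<in> W" and st: "0 \<le> s" "0 \<le> t" "s + t = 1"
    obtain a y a' y' where *: "u = a - y + b" "v = a' - y' + b" "a \<in> interior A" "a' \<in> interior A"
      "y \<in> interior B" "y' \<in> interior B" using uv unfolding W_def by blast
    have "s *\<^sub>R u + t *\<^sub>R v = (s *\<^sub>R a + t *\<^sub>R a') - (s *\<^sub>R y + t *\<^sub>R y') + (s + t) *\<^sub>R b"
      by (simp add: * algebra_simps)
    then show "s *\<^sub>R u + t *\<^sub>R v \<in> W"
      unfolding W_def using * st convexD[OF convex_interior[OF A(1)]] convexD[OF convex_interior[OF B(1)]]
      by (metis (mono_tags, lifting) mem_Collect_eq scaleR_one)
  qed
  moreover have "ball 0 r \<subseteq> W"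
  proof
    fix a :: 'a assume "a \<in> ball 0 r"
    then have "a \<in> interior A" "a = a - b + b" using r by auto
    then show "a \<in> W" unfolding W_def using b by blast
  qed
  ultimately interpret W: convex_nhd_of_0 W r using r(1) by unfold_locales
  have "b \<notin> W"
  proof
    assume "b \<in> W"
    then obtain a y where "b = a - y + b" "a \<in> interior A" "y \<in> interior B" unfolding W_def by blast
    then show False using disj by (auto simp: disjnt_def)
  qed
  then have pb: "1 \<le> gauge_of W b" using W.mem_of_gauge_less(2)[of b 1] by force
  obtain f where f: "linear f" "\<And>u. f u \<le> gauge_of W u" "f b = gauge_of W b"
    by (rule extreme_linear_minorant[OF W.gauge_sublinear, of b]) (rule that)
  have int: "f a \<le> f y" if "a \<in> interior A" "y \<in> interior B" for a y
  proof -
    have "a - y + b \<in> W" using that unfolding W_def by blast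
    then have "gauge_of W (a - y + b) \<le> 1" using W.gauge_le[of 1] by simp
    then have "f (a - y + b) \<le> 1" using f(2) order_trans by blast
    then show ?thesis using f(3) pb by (simp add: linear_add[OF f(1)] linear_diff[OF f(1)])
  qed
  have AB: "f a \<le> f y" if a: "a \<in> A" and y: "y \<in> B" for a y
  proof -
    have shr: "f (a + s *\<^sub>R (0 - a)) \<le> f (y + s *\<^sub>R (b - y))" if "0 < s" "s \<le> 1" for s
      using that by (intro int convex_interior_shrink A B a y b)
    have expand: "f (u + s *\<^sub>R w) = f u + s * f w" for u w s
      using f(1) by (simp add: linear_add linear_scale)
    have lim: "((\<lambda>s. f a + s * f (0 - a)) \<longlongrightarrow> f a + 0 * f (0 - a)) (at_right (0::real))"
      "((\<lambda>s. f y + s * f (b - y)) \<longlongrightarrow> f y + 0 * f (b - y)) (at_right (0::real))"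
      by (intro tendsto_intros)+
    have "\<forall>\<^sub>F s in at_right (0::real). s \<in> {0<..<1}"
      by (rule eventually_at_right_real) simp
    then have "\<forall>\<^sub>F s in at_right (0::real). f a + s * f (0 - a) \<le> f y + s * f (b - y)"
    proof eventually_elim
      case (elim s)
      then show ?case using shr[of s, unfolded expand] by simp
    qed
    from tendsto_le[OF trivial_limit_at_right_real lim(2,1) this] show ?thesis by simp
  qed
  obtain s where s: "0 < s" "0 + s *\<^sub>R b \<in> interior A"
    using eventually_nhds_along_ray[OF eventually_nhds_in_open[OF open_interior A(2)], of b] by metis
  define k where "k = (INF y\<in>B. f y)"
  have Bne: "B \<noteq> {}" using b interior_subset by blast
  have "s *\<^sub>R b \<in> A" using s(2) interior_subset by auto
  then have "f (s *\<^sub>R b) \<le> k" unfolding k_def by (intro cINF_greatest[OF Bne] AB)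
  then have "s * f b \<le> k" using linear_scale[OF f(1), of s b] by simp
  then have k: "0 < k" using mult_pos_pos[of s "f b"] s(1) f(3) pb by linarith
  have "bounded_linear f"
  proof (rule bounded_linear_intro)
    show "norm (f x) \<le> norm x * (1/r)" for x
      using f(2)[of x] f(2)[of "- x"] W.gauge_le_norm[of x] W.gauge_le_norm[of "- x"]
        linear_neg[OF f(1), of x] by simp
  qed (use f(1) in \<open>simp_all add: linear_add linear_scale\<close>)
  then have F: "blinfun_apply (Blinfun f) = f" by (rule bounded_linear_Blinfun_apply)
  show thesis
  proof (rule that[of "(1/k) *\<^sub>R Blinfun f"])
    fix a assume a: "a \<in> A"
    have "f a \<le> k" unfolding k_def by (intro cINF_greatest[OF Bne] AB a)
    then show "blinfun_apply ((1/k) *\<^sub>R Blinfun f) a \<le> 1" using k by (simp add: F blinfun.scaleR_left)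
  next
    fix y assume y: "y \<in> B"
    have "0 \<in> A" using A(2) interior_subset by blast
    then have "bdd_below (f ` B)" using AB by (intro bdd_belowI2[of _ "f 0"]) auto
    then have "k \<le> f y" unfolding k_def by (rule cINF_lower[OF _ y])
    then show "1 \<le> blinfun_apply ((1/k) *\<^sub>R Blinfun f) y" using k by (simp add: F blinfun.scaleR_left)
  qed
qed

text \<open>The functionals separate \<open>C\<close> from the finitely many other tiles that come near the point.  If all of
  them are less than \<open>1\<close> at a nearby point, none of the other tiles contains that
  point, so \<open>C\<close> does.\<close>

lemma tile_locally_polyhedral:
  fixes T :: "'a::real_normed_vector set set"
  assumes T: "tiling T" "locally_finite_in euclidean T" and C: "C \<in> T" "c \<in> interior C"
  obtains U and H :: "('a \<Rightarrow>\<^sub>L real) set" where "open U" "x \<in> U" "finite H"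
    "\<And>g y. g \<in> H \<Longrightarrow> y + c \<in> C \<Longrightarrow> blinfun_apply g y \<le> 1"
    "\<And>y. y \<in> U \<Longrightarrow> (\<And>g. g \<in> H \<Longrightarrow> blinfun_apply g y < 1) \<Longrightarrow> y + c \<in> C"
proof -
  let ?s = "\<lambda>D. (\<lambda>y. y - c) ` D"
  have trans: "interior (?s D) = ?s (interior D)" for D
    using interior_translation[of "- c" D] by (simp add: image_def)
  have body: "convex D" "interior D \<noteq> {}" if "D \<in> T" for D
    using T(1) that by (auto simp: tiling_def convex_body_def)
  have conv: "convex (?s D)" if "D \<in> T" for D
    using convex_translation_subtract[OF body(1)[OF that]] by simp
  have "\<exists>g :: 'a \<Rightarrow>\<^sub>L real. (\<forall>a\<in>?s C. blinfun_apply g a \<le> 1) \<and> (\<forall>y\<in>?s D. 1 \<le> blinfun_apply g y)"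
    if D: "D \<in> T" "D \<noteq> C" for D
  proof -
    have "disjnt (interior C) (interior D)"
      using T(1) C(1) D unfolding tiling_def pairwise_def by metis
    then have "disjnt (interior (?s C)) (interior (?s D))"
      unfolding trans by (auto simp: disjnt_def)
    moreover have "0 \<in> interior (?s C)" "interior (?s D) \<noteq> {}"
      unfolding trans using C(2) body(2)[OF D(1)] by auto
    ultimately show ?thesis
      using separate_convex_bodies[of "?s C" "?s D"] conv C(1) D(1) by metis
  qed
  then obtain g :: "'a set \<Rightarrow> 'a \<Rightarrow>\<^sub>L real" where g:
    "\<And>D a. D \<in> T \<Longrightarrow> D \<noteq> C \<Longrightarrow> a \<in> ?s C \<Longrightarrow> blinfun_apply (g D) a \<le> 1"
    "\<And>D y. D \<in> T \<Longrightarrow> D \<noteq> C \<Longrightarrow> y \<in> ?s D \<Longrightarrow> 1 \<le> blinfun_apply (g D) y"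
    by metis
  have shift: "y \<in> ?s D \<longleftrightarrow> y + c \<in> D" for y D by (force simp: image_iff)
  obtain V where V: "open V" "x + c \<in> V" "finite {D \<in> T. D \<inter> V \<noteq> {}}"
    using T(2) by (auto simp: locally_finite_in_def)
  define U where "U = (\<lambda>y. y + c) -` V"
  show thesis
  proof (rule that[of U "g ` ({D \<in> T. D \<inter> V \<noteq> {}} - {C})"])
    show "open U" unfolding U_def
      by (intro open_vimage V(1) continuous_on_add continuous_on_id continuous_on_const)
    show "x \<in> U" using V(2) by (simp add: U_def)
    show "finite (g ` ({D \<in> T. D \<inter> V \<noteq> {}} - {C}))" using V(3) by simp
    show "blinfun_apply h y \<le> 1"
      if "h \<in> g ` ({D \<in> T. D \<inter> V \<noteq> {}} - {C})" "y + c \<in> C" for h y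
      using that g(1) shift by auto
    fix y assume y: "y \<in> U"
      and lt: "\<And>h. h \<in> g ` ({D \<in> T. D \<inter> V \<noteq> {}} - {C}) \<Longrightarrow> blinfun_apply h y < 1"
    obtain D where D: "D \<in> T" "y + c \<in> D" using T(1) unfolding tiling_def by blast
    have "D = C"
    proof (rule ccontr)
      assume "D \<noteq> C"
      have "D \<inter> V \<noteq> {}" using D(2) y by (auto simp: U_def)
      then have "blinfun_apply (g D) y < 1" using lt D(1) \<open>D \<noteq> C\<close> by blast
      moreover have "1 \<le> blinfun_apply (g D) y" using g(2)[OF D(1) \<open>D \<noteq> C\<close>] shift D(2) by blast
      ultimately show False by simp
    qed
    then show "y + c \<in> C" using D(2) by simp
  qed
qed

text \<open>Intersecting the translated tile with its reflection makes it symmetric, and its local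
  description by finitely many inequalities survives with the functionals of both parts.  If near \<open>x\<close> all
  these functionals were strictly below \<open>N\<close> at some \<open>y\<close>, then \<open>(1/s) *\<^sub>R y\<close> would lie in the unit ball for some
  \<open>s\<close> less than \<open>N y\<close>.\<close>

lemma tiling_imp_locally_polyhedral_norm:
  fixes T :: "'a::real_normed_vector set set"
  assumes T: "tiling T" "\<forall>C\<in>T. bounded C" "locally_finite_in euclidean T"
  shows "\<exists>N :: 'a \<Rightarrow> real. equivalent_norm N \<and> locally_polyhedral N"
proof -
  obtain C where C: "C \<in> T" using T(1) by (auto simp: tiling_def)
  then have body: "convex C" "interior C \<noteq> {}" using T(1) by (auto simp: tiling_def convex_body_def)
  obtain c where c: "c \<in> interior C" using body(2) by blast
  obtain r where r: "0 < r" "ball c r \<subseteq> C" using c by (auto simp: mem_interior)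
  define D where "D = {y. y + c \<in> C \<and> - y + c \<in> C}"
  have convD: "convex D"
  proof (rule convexI)
    fix u v and s t :: real assume uv: "u \<in> D" "v \<in> D" and st: "0 \<le> s" "0 \<le> t" "s + t = 1"
    have eq: "s *\<^sub>R (u' + c) + t *\<^sub>R (v' + c) = (s *\<^sub>R u' + t *\<^sub>R v') + c" for u' v'
    proof -
      have "s *\<^sub>R (u' + c) + t *\<^sub>R (v' + c) = (s *\<^sub>R u' + t *\<^sub>R v') + (s + t) *\<^sub>R c"
        by (simp add: algebra_simps)
      then show ?thesis using st by simp
    qed
    have "s *\<^sub>R (u + c) + t *\<^sub>R (v + c) \<in> C" "s *\<^sub>R (- u + c) + t *\<^sub>R (- v + c) \<in> C"
      using uv st by (auto simp: D_def intro!: convexD[OF body(1)])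
    then show "s *\<^sub>R u + t *\<^sub>R v \<in> D" unfolding eq by (simp add: D_def algebra_simps)
  qed
  have ballD: "ball 0 r \<subseteq> D"
    using r(2) by (auto simp: D_def dist_norm subset_iff norm_minus_commute)
  interpret D: convex_nhd_of_0 D r using convD r(1) ballD by unfold_locales
  define N where "N = gauge_of D"
  have sub: "sublinear N" unfolding N_def by (rule D.gauge_sublinear)
  have "(1/t) *\<^sub>R (- x) \<in> D \<longleftrightarrow> (1/t) *\<^sub>R x \<in> D" for t x by (auto simp: D_def add.commute)
  then have Nminus: "N (- x) = N x" for x unfolding N_def gauge_of_def by presburger
  obtain R0 where R0: "\<And>y. y \<in> C \<Longrightarrow> norm y \<le> R0" using T(2) C unfolding bounded_iff by blast
  define R where "R = \<bar>R0\<bar> + norm c + 1"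
  have R: "0 < R" by (simp add: R_def add_nonneg_pos)
  have RD: "norm y \<le> R" if "y \<in> D" for y
  proof -
    have "norm y \<le> norm (y + c) + norm c" using norm_triangle_ineq4[of "y + c" c] by simp
    also have "\<dots> \<le> R" using R0[of "y + c"] that by (simp add: D_def R_def)
    finally show ?thesis .
  qed
  have lower: "(1/R) * norm x \<le> N x" for x
    unfolding N_def
  proof (rule dense_ge)
    fix t assume "gauge_of D x < t"
    then have t: "0 < t" "(1/t) *\<^sub>R x \<in> D" using D.mem_of_gauge_less by blast+
    then have "norm x \<le> R * t" using RD[OF t(2)] by (simp add: pos_divide_le_eq)
    then show "(1/R) * norm x \<le> t" using R by (simp add: pos_divide_le_eq mult.commute)
  qed
  have "is_norm N"
    unfolding is_norm_def
  proof (intro conjI allI)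
    show "0 \<le> N x" for x unfolding N_def by (rule D.gauge_nonneg)
    show "N (x + y) \<le> N x + N y" for x y by (rule sublinear_add[OF sub])
    show "N x = 0 \<longleftrightarrow> x = 0" for x
      using lower[of x] R sublinear_zero[OF sub] by (auto simp: divide_le_0_iff)
    show "N (a *\<^sub>R x) = \<bar>a\<bar> * N x" for a x
    proof (cases "0 \<le> a")
      case True then show ?thesis using sublinear_scale[OF sub] by simp
    next
      case False
      then show ?thesis using sublinear_scale[OF sub, of "- a" x] Nminus[of "a *\<^sub>R x"] by simp
    qed
  qed
  moreover have "\<forall>x. (1/R) * norm x \<le> N x \<and> N x \<le> (1/r) * norm x"
    using lower D.gauge_le_norm by (simp add: N_def)
  ultimately have N: "equivalent_norm N"
    unfolding equivalent_norm_def using R r(1)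
    by (intro conjI exI[of _ "1/R"] exI[of _ "1/r"]) auto
  have "locally_polyhedral N"
    unfolding locally_polyhedral_def
  proof (intro allI impI)
    fix x assume x: "N x = 1"
    obtain U1 and H1 :: "('a \<Rightarrow>\<^sub>L real) set" where 1: "open U1" "x \<in> U1" "finite H1"
      "\<And>g y. g \<in> H1 \<Longrightarrow> y + c \<in> C \<Longrightarrow> blinfun_apply g y \<le> 1"
      "\<And>y. y \<in> U1 \<Longrightarrow> (\<And>g. g \<in> H1 \<Longrightarrow> blinfun_apply g y < 1) \<Longrightarrow> y + c \<in> C"
      using tile_locally_polyhedral[OF T(1,3) C c, of x] by metis
    obtain U2 and H2 :: "('a \<Rightarrow>\<^sub>L real) set" where 2: "open U2" "- x \<in> U2" "finite H2"
      "\<And>g y. g \<in> H2 \<Longrightarrow> y + c \<in> C \<Longrightarrow> blinfun_apply g y \<le> 1"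
      "\<And>y. y \<in> U2 \<Longrightarrow> (\<And>g. g \<in> H2 \<Longrightarrow> blinfun_apply g y < 1) \<Longrightarrow> y + c \<in> C"
      using tile_locally_polyhedral[OF T(1,3) C c, of "- x"] by metis
    \<comment> \<open>the functionals found for \<open>C\<close> at \<open>- x\<close>, negated, describe the reflection of \<open>C\<close> at \<open>x\<close>\<close>
    define U where "U = U1 \<inter> uminus -` U2"
    define G where "G = H1 \<union> uminus ` H2"
    have "open (uminus -` U2)" by (intro open_vimage 2(1) continuous_on_minus continuous_on_id)
    then have U: "open U" "x \<in> U" using 1 2 by (auto simp: U_def)
    have G: "finite G" using 1 2 by (simp add: G_def)
    have GD: "blinfun_apply g y \<le> 1" if "g \<in> G" "y \<in> D" for g y
      using that 1(4)[of g y] 2(4)[of "- g" "- y"]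
      by (auto simp: G_def D_def blinfun.minus_left blinfun.minus_right)
    have GN: "blinfun_apply g y \<le> N y" if "g \<in> G" for g y
      unfolding N_def using GD[OF that] by (intro D.functional_le_gauge linear_blinfun_apply)
    have UD: "y \<in> D" if "y \<in> U" "\<And>g. g \<in> G \<Longrightarrow> blinfun_apply g y < 1" for y
    proof -
      have "y + c \<in> C" using that by (intro 1(5)) (auto simp: U_def G_def)
      moreover have "- y + c \<in> C"
      proof (rule 2(5))
        show "- y \<in> U2" using that(1) by (simp add: U_def)
        show "blinfun_apply g (- y) < 1" if "g \<in> H2" for g
          using \<open>\<And>g. g \<in> G \<Longrightarrow> blinfun_apply g y < 1\<close>[of "- g"] that
          by (simp add: G_def blinfun.minus_left blinfun.minus_right)
      qed
      ultimately show ?thesis by (simp add: D_def)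
    qed
    have key: "\<exists>g\<in>G. N y = blinfun_apply g y" if y: "0 < N y" "(1 / N y) *\<^sub>R y \<in> U" for y
    proof (rule ccontr)
      assume "\<not> ?thesis"
      then have lt: "blinfun_apply g y < N y" if "g \<in> G" for g using GN[OF that, of y] that by force
      have "((\<lambda>s. (1/s) *\<^sub>R y) \<longlongrightarrow> (1 / N y) *\<^sub>R y) (at_left (N y))"
        using y(1) by (intro tendsto_intros) auto
      then have "\<forall>\<^sub>F s in at_left (N y). (1/s) *\<^sub>R y \<in> U"
        using U(1) y(2) by (rule topological_tendstoD)
      moreover have "\<forall>\<^sub>F s in at_left (N y). \<forall>g\<in>G. blinfun_apply g y < s"
      proof (rule eventually_ball_finite[OF G], rule ballI)
        fix g assume "g \<in> G"
        then have "\<forall>\<^sub>F s in at_left (N y). s \<in> {blinfun_apply g y<..<N y}"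
          by (intro eventually_at_left_real lt)
        then show "\<forall>\<^sub>F s in at_left (N y). blinfun_apply g y < s" by eventually_elim simp
      qed
      moreover have "\<forall>\<^sub>F s in at_left (N y). s \<in> {0<..<N y}"
        using y(1) by (rule eventually_at_left_real)
      ultimately have "\<forall>\<^sub>F s in at_left (N y). (1/s) *\<^sub>R y \<in> U \<and> (\<forall>g\<in>G. blinfun_apply g y < s) \<and> s \<in> {0<..<N y}"
        by (intro eventually_conj)
      then obtain s where s: "(1/s) *\<^sub>R y \<in> U" "\<And>g. g \<in> G \<Longrightarrow> blinfun_apply g y < s" "0 < s" "s < N y"
        using eventually_happens'[OF trivial_limit_at_left_real] by fastforce
      have "(1/s) *\<^sub>R y \<in> D"
        using s by (intro UD) (auto simp: blinfun.scaleR_right)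
      then have "N y \<le> s" unfolding N_def using D.gauge_le s(3) by blast
      then show False using s(4) by simp
    qed
    have "isCont N x"
      using equivalent_norm_continuous[OF N] by (simp add: continuous_on_eq_continuous_at)
    then have tN: "(N \<longlongrightarrow> N x) (nhds x)" by (simp add: isCont_def tendsto_at_iff_tendsto_nhds)
    have "((\<lambda>y. (1 / N y) *\<^sub>R y) \<longlongrightarrow> (1 / N x) *\<^sub>R x) (nhds x)"
      using x by (intro tendsto_scaleR tendsto_divide tendsto_const tN filterlim_ident) auto
    then have "\<forall>\<^sub>F y in nhds x. (1 / N y) *\<^sub>R y \<in> U"
      using U x by (intro topological_tendstoD) auto
    moreover have "\<forall>\<^sub>F y in nhds x. 0 < N y" using x by (intro order_tendstoD(1)[OF tN]) simp
    ultimately have "\<forall>\<^sub>F y in nhds x. \<exists>g\<in>G. N y = blinfun_apply g y"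
      by eventually_elim (rule key)
    then show "\<exists>G :: ('a \<Rightarrow>\<^sub>L real) set. finite G \<and> (\<forall>g\<in>G. \<forall>y. blinfun_apply g y \<le> N y) \<and>
        (\<forall>\<^sub>F y in nhds x. \<exists>g\<in>G. N y = blinfun_apply g y)"
      using G GN by (intro exI[of _ G]) auto
  qed
  then show ?thesis using N by blast
qed

section \<open>Locally finite tilings and polyhedral norms\<close>

theorem corollary4p8:
  shows "(\<exists>T :: 'a::banach set set.
            tiling T \<and> (\<forall>C\<in>T. bounded C) \<and> locally_finite_in euclidean T)
     \<longleftrightarrow> (\<exists>N :: 'a \<Rightarrow> real.
            equivalent_norm N \<and> K_polyhedral N \<and> property_Delta N)"
proof
  assume "\<exists>T :: 'a set set. tiling T \<and> (\<forall>C\<in>T. bounded C) \<and> locally_finite_in euclidean T"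
  then obtain N :: "'a \<Rightarrow> real" where "equivalent_norm N" "locally_polyhedral N"
    using tiling_imp_locally_polyhedral_norm by blast
  then show "\<exists>N :: 'a \<Rightarrow> real. equivalent_norm N \<and> K_polyhedral N \<and> property_Delta N"
    using locally_polyhedral_imp_K_polyhedral locally_polyhedral_imp_Delta by blast
next
  assume "\<exists>N :: 'a \<Rightarrow> real. equivalent_norm N \<and> K_polyhedral N \<and> property_Delta N"
  then obtain N :: "'a \<Rightarrow> real" where "equivalent_norm N" "locally_polyhedral N"
    using K_polyhedral_Delta_imp_locally_polyhedral by blast
  then show "\<exists>T :: 'a set set. tiling T \<and> (\<forall>C\<in>T. bounded C) \<and> locally_finite_in euclidean T"
    using locally_polyhedral_imp_tiling by blast
qed

end
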